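(* Suppose $X$ is a computable metric space with $\mathcal{Y}\subseteq\{A\in\mathcal{A}(X)\mid \dim A\leq 0\}$ a represented class such that $\delta_{\mathcal{Y}}\leq\delta_{\Pi^0_1(X)}|^{\mathcal{Y}}$ and $\tilde{S}$ is computable. Then \[ E':\subseteq F\rightrightarrows \mathrm{C}_{\Pi^0_1(X)}(X,X),\ (A,B)\mapsto \{f\mid \operatorname{img} f=B\wedge f|_B=\mathrm{id}_B\wedge\operatorname{dom} f=A\} \] (with $\operatorname{dom} E'=\{(A,B)\in F\mid B\neq X\} =\{(A,B)\in\mathcal{Y}\times\mathcal{A}(X)\mid \emptyset\neq B\subseteq A\wedge B\neq X\}$) is $(\delta_5;[\delta_X\to\delta_X]_{\Pi^0_1(X)})$-computable.
   Context: $(X,d,\nu)$ is a computable metric space with Cauchy representation $\delta_X$; $\mathcal{A}(X)$ denotes the class of closed subsets of $X$, $\Sigma^0_1(X)$ the open sets with representation $\delta_{\Sigma^0_1(X)}$ (a name lists ideal open balls whose union is the set), and $\delta_{\Pi^0_1(X)}$ represents a closed set by a $\delta_{\Sigma^0_1(X)}$-name of its complement. $\mathcal{Y}$ carries a representation $\delta_{\mathcal{Y}}$ with $\delta_{\mathcal{Y}}\leq\delta_{\Pi^0_1(X)}|^{\mathcal{Y}}$. The operation $\tilde{S}:\Sigma^0_1(X)^{\mathbb{N}}\times\mathcal{Y}\rightrightarrows\Sigma^0_1(X)^{\mathbb{N}}$ is defined by $\tilde{S}((V_i)_i,Y)=\{(W_i)_i\mid (\forall i)W_i\subseteq V_i\wedge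 \bigcup_i W_i\cap Y=\bigcup_i V_i\cap Y\wedge (\forall i\neq j)\,W_i\cap W_j=\emptyset\}$, and "computable" means $([\delta_{\Sigma^0_1(X)}^{\omega},\delta_{\mathcal{Y}}];\delta_{\Sigma^0_1(X)}^{\omega})$-computable. $F:=\{(A,B)\in\mathcal{Y}\times\mathcal{A}(X)\mid \emptyset\neq B\subseteq A\}$, represented by $\delta_5:=[\delta_{\mathcal{Y}},\delta_{\mathrm{range}}\sqcap\delta_{\mathrm{dist}}^{>}]|^F$, where a $\delta_{\mathrm{range}}$-name of nonempty $B$ lists a sequence of $\delta_X$-names of points of $B$ dense in $B$, a $\delta_{\mathrm{dist}}^{>}$-name of $B$ is a realizer of the distance function $d_B:X\to\overline{\mathbb{R}}$ with values given by enumerating the rationals below them (lower semicomputability), and $\sqcap$ means a name is a pair of names of both kinds. $\mathrm{C}_{\Pi^0_1(X)}(X,X)$ is the set of continuous partial maps $f:\subseteq X\to X$ with closed domain, and $\langle p,q\rangle$ is a $[\delta_X\to\delta_X]_{\Pi^0_1(X)}$-name of $f$ iff $\eta_p$ (the canonical representation $\eta$ of continuous partial functions on Baire space with $G_\delta$ domain) is a $(\delta_X,\delta_X)$-realizer of $f$ and $q$ is a $\delta_{\Pi^0_1(X)}$-name of $\operatorname{dom} f$. *)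

theory Defs
  imports "HOL-Analysis.Analysis"
begin

section \<open>Computability on Baire space\<close>

type_synonym baire = "nat \<Rightarrow> nat"

text \<open>Partial recursive functions relative to an oracle. A program that is run with an oracle
  \<^term>\<open>p\<close> and a number \<^term>\<open>n\<close> produces the \<^term>\<open>n\<close>-th value of the output sequence; this
  describes the same functions on Baire space as Type-2 machines do.\<close>

datatype prog =
    Zero
  | Succ
  | Query
  | Proj nat
  | Comp prog "prog list"
  | PRec prog prog
  | Mu prog

inductive eval :: "baire \<Rightarrow> prog \<Rightarrow> nat list \<Rightarrow> nat \<Rightarrow> bool" for p :: baire where
  eval_Zero: "eval p Zero xs 0"
| eval_Succ: "eval p Succ [x] (Suc x)"
| eval_Query: "eval p Query [x] (p x)"
| eval_Proj: "i < length xs \<Longrightarrow> eval p (Proj i) xs (xs ! i)"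
| eval_Comp: "length ys = length gs \<Longrightarrow> \<forall>i<length gs. eval p (gs ! i) xs (ys ! i)
    \<Longrightarrow> eval p f ys z \<Longrightarrow> eval p (Comp f gs) xs z"
| eval_PRec_0: "eval p f xs y \<Longrightarrow> eval p (PRec f g) (0 # xs) y"
| eval_PRec_Suc: "eval p (PRec f g) (n # xs) y \<Longrightarrow> eval p g (n # y # xs) z
    \<Longrightarrow> eval p (PRec f g) (Suc n # xs) z"
| eval_Mu: "eval p f (n # xs) 0 \<Longrightarrow> \<forall>m<n. \<exists>k. eval p f (m # xs) (Suc k)
    \<Longrightarrow> eval p (Mu f) xs n"

lemma eval_deterministic:
  "eval p f xs y \<Longrightarrow> eval p f xs z \<Longrightarrow> y = z"
proof (induction arbitrary: z rule: eval.induct)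
  case (eval_Comp ys gs xs f w)
  from eval_Comp.prems obtain ys' where ys': "length ys' = length gs"
    "\<forall>i<length gs. eval p (gs ! i) xs (ys' ! i)" "eval p f ys' z"
    by (cases rule: eval.cases) auto
  have "ys = ys'"
    using eval_Comp.hyps(1) eval_Comp.IH(1) ys' by (intro nth_equalityI) auto
  then show ?case using eval_Comp.IH(2) ys'(3) by simp
next
  case (eval_PRec_Suc f g n xs y w)
  from eval_PRec_Suc.prems obtain y' where "eval p (PRec f g) (n # xs) y'" "eval p g (n # y' # xs) z"
    by (cases rule: eval.cases) auto
  then show ?case using eval_PRec_Suc.IH by auto
next
  case (eval_Mu f n xs)
  from eval_Mu.prems have z: "eval p f (z # xs) 0" "\<forall>m<z. \<exists>k. eval p f (m # xs) (Suc k)"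
    by (cases rule: eval.cases; auto)+
  have "\<not> n < z" using eval_Mu.IH(1) z(2) by fastforce
  moreover have "\<not> z < n" using eval_Mu.IH(2) z(1) by fastforce
  ultimately show ?case by simp
qed (erule eval.cases; auto)+

text \<open>Partial functions on Baire space are given by their graphs. The domain of
  \<^term>\<open>machine_fun f\<close> consists of the oracles for which \<^term>\<open>f\<close> produces an infinite output.\<close>

definition machine_fun :: "prog \<Rightarrow> baire \<Rightarrow> baire \<Rightarrow> bool" where
  "machine_fun f p q \<longleftrightarrow> (\<forall>n. eval p f [n] (q n))"

text \<open>\<^term>\<open>eta a\<close> is the continuous partial function with associate \<^term>\<open>a\<close>: the \<^term>\<open>n\<close>-th value
  at \<^term>\<open>p\<close> is \<^term>\<open>m\<close> if \<^term>\<open>Suc m\<close> is what \<^term>\<open>a\<close> assigns to \<^term>\<open>n\<close> and the shortest prefix of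
  \<^term>\<open>p\<close> where \<^term>\<open>a\<close> does not answer 0 (``longer prefix needed''). Its domain is a
  G-delta set, and every continuous partial function on Baire space with G-delta domain has this
  form.\<close>

definition eta :: "baire \<Rightarrow> baire \<Rightarrow> baire \<Rightarrow> bool" where
  "eta a p q \<longleftrightarrow> (\<forall>n. \<exists>k.
     a (prod_encode (n, list_encode (map p [0..<k]))) = Suc (q n) \<and>
     (\<forall>j<k. a (prod_encode (n, list_encode (map p [0..<j]))) = 0))"

lemma eta_functional:
  assumes "eta a p q" "eta a p r"
  shows "q = r"
proof
  fix n
  let ?v = "\<lambda>k. a (prod_encode (n, list_encode (map p [0..<k])))"
  obtain k where k: "?v k = Suc (q n)" "\<forall>j<k. ?v j = 0"
    using assms(1) unfolding eta_def by blast
  obtain l where l: "?v l = Suc (r n)" "\<forall>j<l. ?v j = 0"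
    using assms(2) unfolding eta_def by blast
  have "k = l" using k l by (metis linorder_neqE_nat nat.distinct(1))
  then show "q n = r n" using k(1) l(1) by simp
qed

section \<open>Representations\<close>

text \<open>A representation is given by its graph: \<^term>\<open>\<delta> p x\<close> says that \<^term>\<open>p\<close> is a name of \<^term>\<open>x\<close>.\<close>

type_synonym 'a rep = "baire \<Rightarrow> 'a \<Rightarrow> bool"

definition is_representation :: "'a rep \<Rightarrow> 'a set \<Rightarrow> bool" where
  "is_representation \<delta> S \<longleftrightarrow>
     (\<forall>p x y. \<delta> p x \<longrightarrow> \<delta> p y \<longrightarrow> x = y) \<and> {x. \<exists>p. \<delta> p x} = S"

definition baire_fst :: "baire \<Rightarrow> baire" where
  "baire_fst p = (\<lambda>n. p (2 * n))"

definition baire_snd :: "baire \<Rightarrow> baire" where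
  "baire_snd p = (\<lambda>n. p (2 * n + 1))"

definition baire_nth :: "baire \<Rightarrow> nat \<Rightarrow> baire" where
  "baire_nth p i = (\<lambda>j. p (prod_encode (i, j)))"

definition prod_rep :: "'a rep \<Rightarrow> 'b rep \<Rightarrow> ('a \<times> 'b) rep" where
  "prod_rep \<delta> \<delta>' = (\<lambda>p (x, y). \<delta> (baire_fst p) x \<and> \<delta>' (baire_snd p) y)"

definition seq_rep :: "'a rep \<Rightarrow> (nat \<Rightarrow> 'a) rep" where
  "seq_rep \<delta> p x \<longleftrightarrow> (\<forall>i. \<delta> (baire_nth p i) (x i))"

definition meet_rep :: "'a rep \<Rightarrow> 'a rep \<Rightarrow> 'a rep" where
  "meet_rep \<delta> \<delta>' p x \<longleftrightarrow> \<delta> (baire_fst p) x \<and> \<delta>' (baire_snd p) x"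

definition corestrict :: "'a rep \<Rightarrow> 'a set \<Rightarrow> 'a rep" where
  "corestrict \<delta> S p x \<longleftrightarrow> \<delta> p x \<and> x \<in> S"

text \<open>A multi-valued partial operation maps a point to the set of its admissible values; its domain
  is where this set is nonempty.\<close>

definition mv_dom :: "('a \<Rightarrow> 'b set) \<Rightarrow> 'a set" where
  "mv_dom h = {x. h x \<noteq> {}}"

definition realizer :: "(baire \<Rightarrow> baire \<Rightarrow> bool) \<Rightarrow> 'a rep \<Rightarrow> 'b rep \<Rightarrow> ('a \<Rightarrow> 'b set) \<Rightarrow> bool" where
  "realizer F \<delta> \<delta>' h \<longleftrightarrow>
     (\<forall>p x. \<delta> p x \<and> x \<in> mv_dom h \<longrightarrow> (\<exists>q y. F p q \<and> \<delta>' q y \<and> y \<in> h x))"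

definition mv_computable :: "'a rep \<Rightarrow> 'b rep \<Rightarrow> ('a \<Rightarrow> 'b set) \<Rightarrow> bool" where
  "mv_computable \<delta> \<delta>' h \<longleftrightarrow> (\<exists>f. realizer (machine_fun f) \<delta> \<delta>' h)"

definition reducible :: "'a rep \<Rightarrow> 'a rep \<Rightarrow> bool" where
  "reducible \<delta> \<delta>' \<longleftrightarrow> mv_computable \<delta> \<delta>' (\<lambda>x. {x})"

section \<open>Computable metric spaces\<close>

definition rat_num :: "nat \<Rightarrow> rat" where
  "rat_num n = (case prod_decode n of (i, j) \<Rightarrow> of_int (int_decode i) / of_nat (Suc j))"

definition pos_rat_num :: "nat \<Rightarrow> rat" where
  "pos_rat_num n = (case prod_decode n of (i, j) \<Rightarrow> of_nat (Suc i) / of_nat (Suc j))"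

text \<open>The space need not be complete. The constant oracle makes \<^const>\<open>eval\<close> ordinary partial
  recursive evaluation.\<close>

definition computable_metric_space :: "(nat \<Rightarrow> 'a::metric_space) \<Rightarrow> bool" where
  "computable_metric_space \<nu> \<longleftrightarrow>
     closure (range \<nu>) = UNIV \<and>
     (\<exists>f. \<forall>i j k. \<exists>m. eval (\<lambda>_. 0) f [i, j, k] m \<and>
        \<bar>of_rat (rat_num m) - dist (\<nu> i) (\<nu> j)\<bar> \<le> (1/2) ^ k)"

definition cauchy_rep :: "(nat \<Rightarrow> 'a::metric_space) \<Rightarrow> 'a rep" where
  "cauchy_rep \<nu> p x \<longleftrightarrow>
     (\<forall>i j. i < j \<longrightarrow> dist (\<nu> (p i)) (\<nu> (p j)) < (1/2) ^ i) \<and> (\<lambda>i. \<nu> (p i)) \<longlonglongrightarrow> x"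

definition ideal_ball :: "(nat \<Rightarrow> 'a::metric_space) \<Rightarrow> nat \<Rightarrow> 'a set" where
  "ideal_ball \<nu> n = (case prod_decode n of (i, r) \<Rightarrow> ball (\<nu> i) (of_rat (pos_rat_num r)))"

text \<open>In lists, the entry \<^term>\<open>Suc n\<close> stands for the item with number \<^term>\<open>n\<close> and 0 for no item,
  so that the empty collection has a name.\<close>

definition open_rep :: "(nat \<Rightarrow> 'a::metric_space) \<Rightarrow> 'a set rep" where
  "open_rep \<nu> p U \<longleftrightarrow> U = (\<Union>n \<in> {n. Suc n \<in> range p}. ideal_ball \<nu> n)"

definition closed_rep :: "(nat \<Rightarrow> 'a::metric_space) \<Rightarrow> 'a set rep" where
  "closed_rep \<nu> p A \<longleftrightarrow> open_rep \<nu> p (- A)"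

definition range_rep :: "(nat \<Rightarrow> 'a::metric_space) \<Rightarrow> 'a set rep" where
  "range_rep \<nu> p B \<longleftrightarrow> closed B \<and>
     (\<exists>b. seq_rep (cauchy_rep \<nu>) p b \<and> range b \<subseteq> B \<and> B \<subseteq> closure (range b))"

definition lower_rep :: "ereal rep" where
  "lower_rep p t \<longleftrightarrow> {rat_num n |n. Suc n \<in> range p} = {r. ereal (of_rat r) < t}"

text \<open>\<^const>\<open>infdist\<close> is not used because the distance to the empty set has to be infinite.\<close>

definition dist_fun :: "'a::metric_space set \<Rightarrow> 'a \<Rightarrow> ereal" where
  "dist_fun B x = (INF y\<in>B. ereal (dist x y))"

definition dist_lower_rep :: "(nat \<Rightarrow> 'a::metric_space) \<Rightarrow> 'a set rep" where
  "dist_lower_rep \<nu> p B \<longleftrightarrow>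
     closed B \<and> realizer (eta p) (cauchy_rep \<nu>) lower_rep (\<lambda>x. {dist_fun B x})"

definition cont_closed_dom :: "('a::topological_space \<rightharpoonup> 'b::topological_space) set" where
  "cont_closed_dom = {f. closed (dom f) \<and> continuous_on (dom f) (\<lambda>x. the (f x))}"

definition cont_closed_dom_rep :: "(nat \<Rightarrow> 'a::metric_space) \<Rightarrow> ('a \<rightharpoonup> 'a) rep" where
  "cont_closed_dom_rep \<nu> p f \<longleftrightarrow>
     f \<in> cont_closed_dom \<and>
     realizer (eta (baire_fst p)) (cauchy_rep \<nu>) (cauchy_rep \<nu>) (\<lambda>x. set_option (f x)) \<and>
     closed_rep \<nu> (baire_snd p) (dom f)"

section \<open>The operations\<close>

definition S_tilde ::
  "'a::metric_space set set \<Rightarrow> (nat \<Rightarrow> 'a set) \<times> 'a set \<Rightarrow> (nat \<Rightarrow> 'a set) set" where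
  "S_tilde \<Y> = (\<lambda>(V, Y). {W. (\<forall>i. open (V i)) \<and> Y \<in> \<Y> \<and> (\<forall>i. open (W i)) \<and>
     (\<forall>i. W i \<subseteq> V i) \<and> (\<Union>i. W i) \<inter> Y = (\<Union>i. V i) \<inter> Y \<and>
     (\<forall>i j. i \<noteq> j \<longrightarrow> W i \<inter> W j = {})})"

definition pairs_F :: "'a::metric_space set set \<Rightarrow> ('a set \<times> 'a set) set" where
  "pairs_F \<Y> = {(A, B). A \<in> \<Y> \<and> closed B \<and> B \<noteq> {} \<and> B \<subseteq> A}"

definition delta5 ::
  "(nat \<Rightarrow> 'a::metric_space) \<Rightarrow> 'a set set \<Rightarrow> 'a set rep \<Rightarrow> ('a set \<times> 'a set) rep" where
  "delta5 \<nu> \<Y> \<delta>Y =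
     corestrict (prod_rep \<delta>Y (meet_rep (range_rep \<nu>) (dist_lower_rep \<nu>))) (pairs_F \<Y>)"

definition E_retract ::
  "'a::metric_space set set \<Rightarrow> 'a set \<times> 'a set \<Rightarrow> ('a \<rightharpoonup> 'a) set" where
  "E_retract \<Y> = (\<lambda>(A, B). {f \<in> cont_closed_dom. (A, B) \<in> pairs_F \<Y> \<and> B \<noteq> UNIV \<and>
     ran f = B \<and> (\<forall>x\<in>B. f x = Some x) \<and> dom f = A})"

end

theory Submission
  imports Defs
begin

text \<open>Cover the complement of \<open>B\<close> by ideal balls whose radius is at most half the distance of their
  centre to \<open>B\<close>; that a ball is of this kind can be confirmed from the lower name of the distance
  function. Use the hypothesis on \<^const>\<open>S_tilde\<close> to replace these balls by disjoint open sets \<open>W s\<close>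
  that still cover \<open>A - B\<close>, and let \<open>f\<close> be the identity on \<open>B\<close> and, on \<open>A \<inter> W s\<close>, constantly a
  point \<open>b\<close> of \<open>B\<close> whose distance to the centre is less than twice that of \<open>B\<close>. Then
  \<open>dist (f x) x \<le> 5 * infdist x B\<close>, so \<open>f\<close> is continuous, and \<open>f x\<close> can be approximated by running two
  searches in parallel: either \<open>x\<close> turns out to be so close to \<open>B\<close> that \<open>x\<close> itself is a good
  approximation, or \<open>x\<close> turns out to lie in some \<open>W s\<close>. Each \<open>s\<close> also carries the evidence for the
  choice of its ball and its point, so all tests are decidable; the associate of \<open>f\<close> only bounds the
  parallel search by the prefix that it is given.\<close>

section \<open>Uniformly computable functions\<close>

lemma eval_Comp1: "eval p g xs a \<Longrightarrow> eval p f [a] z \<Longrightarrow> eval p (Comp f [g]) xs z"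
  by (rule eval_Comp[of "[a]"]) auto

lemma eval_Comp2:
  "eval p g xs a \<Longrightarrow> eval p h xs b \<Longrightarrow> eval p f [a, b] z \<Longrightarrow> eval p (Comp f [g, h]) xs z"
  by (rule eval_Comp[of "[a, b]"]) (auto simp: less_Suc_eq)

lemma eval_Comp3:
  "eval p g xs a \<Longrightarrow> eval p h xs b \<Longrightarrow> eval p k xs c \<Longrightarrow> eval p f [a, b, c] z \<Longrightarrow>
    eval p (Comp f [g, h, k]) xs z"
  by (rule eval_Comp[of "[a, b, c]"]) (auto simp: less_Suc_eq)

lemma eval_Proj':
  "i < length xs \<Longrightarrow> y = xs ! i \<Longrightarrow> eval p (Proj i) xs y"
  by (simp add: eval_Proj)

lemma eval_PRec:
  assumes "eval p f xs (F 0)"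
    and "\<And>m. m < n \<Longrightarrow> eval p g (m # F m # xs) (F (Suc m))"
  shows "eval p (PRec f g) (n # xs) (F n)"
  using assms(2) by (induction n) (auto intro: eval_PRec_0 eval_PRec_Suc assms(1))

definition "prog_add = PRec (Proj 0) (Comp Succ [Proj 1])"

lemma eval_add: "eval p prog_add [x, y] (x + y)"
  unfolding prog_add_def
  by (rule eval_PRec[where F = "\<lambda>x. x + y"]) (auto intro!: eval_Proj' eval_Comp1 eval_Succ)

definition "prog_pred = PRec Zero (Proj 0)"

lemma eval_pred: "eval p prog_pred [x] (x - 1)"
  unfolding prog_pred_def
  by (rule eval_PRec[where F = "\<lambda>x. x - 1"]) (auto intro!: eval_Proj' eval_Zero)

definition "prog_diff = Comp (PRec (Proj 0) (Comp prog_pred [Proj 1])) [Proj 1, Proj 0]"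

lemma eval_diff: "eval p prog_diff [x, y] (x - y)"
  unfolding prog_diff_def
proof (rule eval_Comp2)
  have *: "eval p prog_pred [x - m] (x - Suc m)" for m
    using eval_pred[of p "x - m"] by simp
  show "eval p (PRec (Proj 0) (Comp prog_pred [Proj 1])) [y, x] (x - y)"
    by (rule eval_PRec[where F = "\<lambda>y. x - y"]) (auto intro!: eval_Proj' eval_Comp1 *)
qed (auto intro!: eval_Proj')

definition "prog_mult = PRec Zero (Comp prog_add [Proj 2, Proj 1])"

lemma eval_mult: "eval p prog_mult [x, y] (x * y)"
  unfolding prog_mult_def
proof (rule eval_PRec[where F = "\<lambda>x. x * y"])
  fix m
  show "eval p (Comp prog_add [Proj 2, Proj 1]) [m, m * y, y] (Suc m * y)"
    using eval_add[of p y "m * y"] by (auto intro!: eval_Proj' eval_Comp2)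
qed (auto intro: eval_Zero)

definition "prog_triangle = PRec Zero (Comp prog_add [Proj 1, Comp Succ [Proj 0]])"

lemma eval_triangle: "eval p prog_triangle [x] (triangle x)"
  unfolding prog_triangle_def
proof (rule eval_PRec[where F = triangle])
  fix m
  show "eval p (Comp prog_add [Proj 1, Comp Succ [Proj 0]]) [m, triangle m] (triangle (Suc m))"
    using eval_add[of p "triangle m" "Suc m"]
    by (auto intro!: eval_Proj' eval_Comp2 eval_Comp1 eval_Succ)
qed (auto intro: eval_Zero)

text \<open>The recursion step receives the counter, the previous value and then \<open>x\<close>
  and \<open>y\<close>, so \<open>Proj 3\<close> returns \<open>y\<close>; the base case returns
  \<open>x\<close>.\<close>

definition "prog_cond = PRec (Proj 0) (Proj 3)"

lemma eval_cond: "eval p prog_cond [c, x, y] (if c = 0 then x else y)"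
  unfolding prog_cond_def
  by (rule eval_PRec[where F = "\<lambda>c. if c = 0 then x else y"]) (auto intro!: eval_Proj')

section \<open>Pairing and unpairing\<close>

definition "prog_pair =
  Comp prog_add [Comp prog_triangle [prog_add], Proj 0]"

lemma eval_pair: "eval p prog_pair [x, y] (prod_encode (x, y))"
  unfolding prog_pair_def prod_encode_def prod.case
  by ((rule eval_Comp2 eval_Comp1 eval_Proj' eval_add eval_triangle) | simp)+

text \<open>Decoding goes through the number of the diagonal on which the \<open>n\<close>-th pair lies because
  primitive recursion carries a single number and not a pair.\<close>

primrec diagonal :: "nat \<Rightarrow> nat" where
  "diagonal 0 = 0"
| "diagonal (Suc n) = (if triangle (Suc (diagonal n)) - Suc n = 0 then Suc (diagonal n) else diagonal n)"

text \<open>The truncated difference vanishes exactly when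
  \<open>triangle (Suc (diagonal n)) \<le> Suc n\<close>, that is, when the next diagonal begins at
  \<open>Suc n\<close>; hence both bounds are preserved.\<close>

lemma diagonal_bounds: "triangle (diagonal n) \<le> n \<and> n < triangle (Suc (diagonal n))"
  by (induction n) auto

definition pfst :: "nat \<Rightarrow> nat" where "pfst n = fst (prod_decode n)"
definition psnd :: "nat \<Rightarrow> nat" where "psnd n = snd (prod_decode n)"

lemma pfst_encode [simp]: "pfst (prod_encode (a, b)) = a"
  and psnd_encode [simp]: "psnd (prod_encode (a, b)) = b"
  by (simp_all add: pfst_def psnd_def)

lemma prod_decode_eq_pair: "prod_decode n = (pfst n, psnd n)"
  by (simp add: pfst_def psnd_def)

text \<open>The code of \<open>(a, b)\<close> is \<open>triangle (a + b) + a\<close>: the diagonal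
  number is \<open>a + b\<close>, and the excess over the triangular number is
  \<open>a\<close>.\<close>

lemma diagonal_eq: "pfst n = n - triangle (diagonal n)" "psnd n = diagonal n - pfst n"
proof -
  let ?a = "n - triangle (diagonal n)"
  have le: "?a \<le> diagonal n" and n: "triangle (diagonal n) + ?a = n"
    using diagonal_bounds[of n] by auto
  then have "prod_encode (?a, diagonal n - ?a) = n"
    by (simp add: prod_encode_def)
  then show "pfst n = ?a" "psnd n = diagonal n - pfst n"
    by (metis pfst_encode, metis pfst_encode psnd_encode)
qed

definition "prog_diagonal = PRec Zero (Comp prog_cond
  [Comp prog_diff [Comp prog_triangle [Comp Succ [Proj 1]], Comp Succ [Proj 0]],
   Comp Succ [Proj 1], Proj 1])"

lemma eval_diagonal: "eval p prog_diagonal [x] (diagonal x)"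
  unfolding prog_diagonal_def
proof (rule eval_PRec[where F = diagonal])
  fix m
  show "eval p (Comp prog_cond
    [Comp prog_diff [Comp prog_triangle [Comp Succ [Proj 1]], Comp Succ [Proj 0]],
     Comp Succ [Proj 1], Proj 1]) [m, diagonal m] (diagonal (Suc m))"
    unfolding diagonal.simps
    by ((rule eval_Comp3 eval_Comp2 eval_Comp1 eval_Proj' eval_Succ eval_triangle eval_diff eval_cond)
      | simp only: length_Cons nth_Cons_0 nth_Cons_Suc One_nat_def list.size zero_less_Suc Suc_less_eq)+
qed (auto intro: eval_Zero)

definition "prog_fst = Comp prog_diff [Proj 0, Comp prog_triangle [prog_diagonal]]"

lemma eval_fst: "eval p prog_fst [x] (pfst x)"
  unfolding prog_fst_def diagonal_eq
  by ((rule eval_Comp2 eval_Comp1 eval_Proj' eval_diff eval_triangle eval_diagonal) | simp)+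

definition "prog_snd = Comp prog_diff [prog_diagonal, prog_fst]"

lemma eval_snd: "eval p prog_snd [x] (psnd x)"
  unfolding prog_snd_def diagonal_eq
  by (rule eval_Comp2 eval_diff eval_diagonal eval_fst[unfolded diagonal_eq(1)])+

text \<open>One program has to serve all oracles in \<open>D\<close>. The restriction to
  \<open>D\<close> admits functions obtained from realizers, which are certain to halt only on
  names.\<close>

definition computable_on :: "baire set \<Rightarrow> (baire \<Rightarrow> nat \<Rightarrow> nat) \<Rightarrow> bool" where
  "computable_on D F \<longleftrightarrow> (\<exists>f. \<forall>r\<in>D. \<forall>n. eval r f [n] (F r n))"

text \<open>Truth is coded by 0, so that a decision can be passed to \<open>prog_cond\<close>
  directly.\<close>

definition decidable_on :: "baire set \<Rightarrow> (baire \<Rightarrow> nat \<Rightarrow> bool) \<Rightarrow> bool" where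
  "decidable_on D P \<longleftrightarrow> computable_on D (\<lambda>r n. if P r n then 0 else 1)"

section \<open>Closure properties of uniformly computable functions\<close>

named_theorems computable

lemma computable_onI: "(\<And>r n. r \<in> D \<Longrightarrow> eval r f [n] (F r n)) \<Longrightarrow> computable_on D F"
  unfolding computable_on_def by blast

lemma computable_onE:
  assumes "computable_on D F"
  obtains f where "\<And>r n. r \<in> D \<Longrightarrow> eval r f [n] (F r n)"
  using assms unfolding computable_on_def by blast

lemma computable_on_comp1:
  assumes h: "\<And>r x. r \<in> D \<Longrightarrow> eval r h [x] (H r x)" and "computable_on D F"
  shows "computable_on D (\<lambda>r n. H r (F r n))"
proof -
  obtain f where "\<And>r n. r \<in> D \<Longrightarrow> eval r f [n] (F r n)"
    using assms(2) by (rule computable_onE) blast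
  then show ?thesis by (intro computable_onI[of D "Comp h [f]"] eval_Comp1[OF _ h])
qed

lemma computable_on_comp2:
  assumes h: "\<And>r x y. r \<in> D \<Longrightarrow> eval r h [x, y] (H r x y)"
    and "computable_on D F" "computable_on D G"
  shows "computable_on D (\<lambda>r n. H r (F r n) (G r n))"
proof -
  obtain f where "\<And>r n. r \<in> D \<Longrightarrow> eval r f [n] (F r n)"
    using assms(2) by (rule computable_onE) blast
  moreover obtain g where "\<And>r n. r \<in> D \<Longrightarrow> eval r g [n] (G r n)"
    using assms(3) by (rule computable_onE) blast
  ultimately show ?thesis by (intro computable_onI[of D "Comp h [f, g]"] eval_Comp2[OF _ _ h])
qed

lemma computable_on_comp3:
  assumes h: "\<And>r x y z. r \<in> D \<Longrightarrow> eval r h [x, y, z] (H r x y z)"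
    and "computable_on D F" "computable_on D G" "computable_on D K"
  shows "computable_on D (\<lambda>r n. H r (F r n) (G r n) (K r n))"
proof -
  obtain f where "\<And>r n. r \<in> D \<Longrightarrow> eval r f [n] (F r n)"
    using assms(2) by (rule computable_onE) blast
  moreover obtain g where "\<And>r n. r \<in> D \<Longrightarrow> eval r g [n] (G r n)"
    using assms(3) by (rule computable_onE) blast
  moreover obtain k where "\<And>r n. r \<in> D \<Longrightarrow> eval r k [n] (K r n)"
    using assms(4) by (rule computable_onE) blast
  ultimately show ?thesis
    by (intro computable_onI[of D "Comp h [f, g, k]"] eval_Comp3[OF _ _ _ h])
qed

lemma computable_on_subst:
  assumes "computable_on D H" "computable_on D F"
  shows "computable_on D (\<lambda>r n. H r (F r n))"
proof -
  obtain h where "\<And>r n. r \<in> D \<Longrightarrow> eval r h [n] (H r n)"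
    using assms(1) by (rule computable_onE) blast
  then show ?thesis by (rule computable_on_comp1[OF _ assms(2)])
qed

lemma decidable_on_subst:
  assumes "decidable_on D P" "computable_on D F"
  shows "decidable_on D (\<lambda>r n. P r (F r n))"
  using computable_on_subst[OF assms(1)[unfolded decidable_on_def] assms(2)]
  unfolding decidable_on_def .

lemma computable_on_id [computable]: "computable_on D (\<lambda>r n. n)"
  unfolding computable_on_def by (rule exI[of _ "Proj 0"]) (auto intro!: eval_Proj')

lemma computable_on_Suc [computable]:
  "computable_on D F \<Longrightarrow> computable_on D (\<lambda>r n. Suc (F r n))"
  by (rule computable_on_comp1) (rule eval_Succ)

lemma computable_on_const [computable]: "computable_on D (\<lambda>r n. c)"
proof (induction c)
  case 0
  show ?case unfolding computable_on_def by (auto intro: eval_Zero)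
qed (rule computable_on_Suc)

lemma computable_on_oracle [computable]:
  "computable_on D F \<Longrightarrow> computable_on D (\<lambda>r n. r (F r n))"
  by (rule computable_on_comp1) (rule eval_Query)

lemma computable_on_add [computable]:
  "computable_on D F \<Longrightarrow> computable_on D G \<Longrightarrow> computable_on D (\<lambda>r n. F r n + G r n)"
  by (rule computable_on_comp2) (rule eval_add)

lemma computable_on_diff [computable]:
  "computable_on D F \<Longrightarrow> computable_on D G \<Longrightarrow> computable_on D (\<lambda>r n. F r n - G r n)"
  by (rule computable_on_comp2) (rule eval_diff)

lemma computable_on_mult [computable]:
  "computable_on D F \<Longrightarrow> computable_on D G \<Longrightarrow> computable_on D (\<lambda>r n. F r n * G r n)"
  by (rule computable_on_comp2) (rule eval_mult)

lemma computable_on_pair [computable]: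
  "computable_on D F \<Longrightarrow> computable_on D G \<Longrightarrow> computable_on D (\<lambda>r n. prod_encode (F r n, G r n))"
  by (rule computable_on_comp2) (rule eval_pair)

lemma computable_on_pfst [computable]:
  "computable_on D F \<Longrightarrow> computable_on D (\<lambda>r n. pfst (F r n))"
  by (rule computable_on_comp1) (rule eval_fst)

lemma computable_on_psnd [computable]:
  "computable_on D F \<Longrightarrow> computable_on D (\<lambda>r n. psnd (F r n))"
  by (rule computable_on_comp1) (rule eval_snd)

lemma computable_on_if [computable]:
  assumes "decidable_on D P" "computable_on D F" "computable_on D G"
  shows "computable_on D (\<lambda>r n. if P r n then F r n else G r n)"
proof -
  have "computable_on D (\<lambda>r n. if (if P r n then 0 else 1::nat) = 0 then F r n else G r n)"
    by (rule computable_on_comp3[OF eval_cond assms(1)[unfolded decidable_on_def] assms(2,3)])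
  moreover have "((if a then 0 else 1::nat) = 0) = a" for a
    by simp
  ultimately show ?thesis by (simp only:)
qed

text \<open>The step function sees the tuple (parameter, counter, previous value) as one number.\<close>

lemma computable_on_rec [computable]:
  assumes F: "computable_on D F"
    and G: "computable_on D (\<lambda>r z. G r (pfst z) (pfst (psnd z)) (psnd (psnd z)))"
    and N: "computable_on D N"
  shows "computable_on D (\<lambda>r n. rec_nat (F r n) (G r n) (N r n))"
proof -
  obtain f where f: "\<And>r n. r \<in> D \<Longrightarrow> eval r f [n] (F r n)"
    using F by (rule computable_onE) blast
  obtain g where g: "\<And>r z. r \<in> D \<Longrightarrow> eval r g [z] (G r (pfst z) (pfst (psnd z)) (psnd (psnd z)))"
    using G by (rule computable_onE) blast
  define h where "h = PRec f (Comp g [Comp prog_pair [Proj 2, Comp prog_pair [Proj 0, Proj 1]]])"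
  have "eval r h [k, n] (rec_nat (F r n) (G r n) k)" if "r \<in> D" for r k n
    unfolding h_def
  proof (rule eval_PRec[where F = "rec_nat (F r n) (G r n)"])
    fix m
    let ?y = "rec_nat (F r n) (G r n) m"
    have "eval r g [prod_encode (n, prod_encode (m, ?y))] (rec_nat (F r n) (G r n) (Suc m))"
      using g[OF that, of "prod_encode (n, prod_encode (m, ?y))"] by simp
    then show "eval r (Comp g [Comp prog_pair [Proj 2, Comp prog_pair [Proj 0, Proj 1]]])
        [m, ?y, n] (rec_nat (F r n) (G r n) (Suc m))"
      by (rule eval_Comp1[rotated]) ((rule eval_Comp2[OF _ _ eval_pair] eval_Proj') | simp)+
  qed (simp add: f that)
  from computable_on_comp2[OF this N computable_on_id] show ?thesis by simp
qed

section \<open>Decidable predicates and further arithmetic\<close>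

lemma decidable_on_zero [computable]:
  assumes "computable_on D F"
  shows "decidable_on D (\<lambda>r n. F r n = 0)"
proof -
  have "computable_on D (\<lambda>r n. 1 - (1 - F r n))"
    by (intro computable assms)
  moreover have "1 - (1 - x) = (if x = 0 then 0 else 1)" for x :: nat by auto
  ultimately show ?thesis unfolding decidable_on_def by simp
qed

lemma decidable_on_le [computable]:
  "computable_on D F \<Longrightarrow> computable_on D G \<Longrightarrow> decidable_on D (\<lambda>r n. F r n \<le> G r n)"
  using decidable_on_zero[OF computable_on_diff[of D F G]] by simp

lemma decidable_on_less [computable]:
  "computable_on D F \<Longrightarrow> computable_on D G \<Longrightarrow> decidable_on D (\<lambda>r n. F r n < G r n)"
  using decidable_on_le[OF computable_on_Suc[of D F]] by (simp add: Suc_le_eq)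

lemma decidable_on_not [computable]:
  assumes "decidable_on D P"
  shows "decidable_on D (\<lambda>r n. \<not> P r n)"
proof -
  have "decidable_on D (\<lambda>r n. (if P r n then 1 else 0::nat) = 0)"
    by (intro computable assms)
  moreover have "((if a then 1 else 0::nat) = 0) = (\<not> a)" for a
    by simp
  ultimately show ?thesis by (simp only:)
qed

lemma decidable_on_conj [computable]:
  assumes "decidable_on D P" "decidable_on D Q"
  shows "decidable_on D (\<lambda>r n. P r n \<and> Q r n)"
proof -
  have "computable_on D (\<lambda>r n. if P r n then (if Q r n then 0 else 1) else 1)"
    by (intro computable assms)
  moreover have "(if a then (if b then 0 else 1) else 1) = (if a \<and> b then 0 else (1::nat))" for a b
    by simp
  ultimately show ?thesis unfolding decidable_on_def by simp
qed

lemma decidable_on_eq [computable]: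
  assumes "computable_on D F" "computable_on D G"
  shows "decidable_on D (\<lambda>r n. F r n = G r n)"
  unfolding eq_iff[of "F _ _"] by (intro computable assms)

lemma decidable_on_All_less [computable]:
  assumes P: "decidable_on D (\<lambda>r z. P r (pfst z) (psnd z))" and N: "computable_on D N"
  shows "decidable_on D (\<lambda>r n. \<forall>k<N r n. P r n k)"
proof -
  have rec: "rec_nat 0 (\<lambda>k y. if y = 0 \<and> P r n k then 0 else 1) m = (if \<forall>k<m. P r n k then 0 else (1::nat))"
    for r n m by (induction m) (auto simp: less_Suc_eq)
  \<comment> \<open>The recursion step sees \<open>(n, (k, y))\<close>, whereas the assumption on
    \<open>P\<close> speaks of \<open>(n, k)\<close>.\<close>
  have P': "decidable_on D (\<lambda>r z. P r (pfst z) (pfst (psnd z)))"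
    using decidable_on_subst[OF P, of "\<lambda>r z. prod_encode (pfst z, pfst (psnd z))"]
    by (simp add: computable)
  show ?thesis
    unfolding decidable_on_def rec[symmetric] by (intro computable P' N)
qed

lemma computable_on_power [computable]:
  assumes "computable_on D F" "computable_on D G"
  shows "computable_on D (\<lambda>r n. F r n ^ G r n)"
proof -
  have "computable_on D (\<lambda>r n. rec_nat 1 (\<lambda>_ y. F r n * y) (G r n))"
    by (intro computable assms computable_on_subst[OF assms(1)])
  moreover have "rec_nat 1 (\<lambda>_ y. a * y) m = a ^ m" for a m :: nat
    by (induction m) auto
  ultimately show ?thesis by simp
qed

lemma decidable_on_even [computable]:
  assumes "computable_on D F"
  shows "decidable_on D (\<lambda>r n. even (F r n))"
proof -
  have "computable_on D (\<lambda>r n. rec_nat 0 (\<lambda>_ y. 1 - y) (F r n))"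
    by (intro computable assms)
  moreover have "rec_nat 0 (\<lambda>_ y. 1 - y) m = (if even m then 0 else (1::nat))" for m
    by (induction m) auto
  ultimately show ?thesis unfolding decidable_on_def by simp
qed

lemma computable_on_half [computable]:
  assumes "computable_on D F"
  shows "computable_on D (\<lambda>r n. F r n div 2)"
proof -
  have "computable_on D (\<lambda>r n. rec_nat 0 (\<lambda>k y. if even k then y else Suc y) (F r n))"
    by (intro computable assms)
  moreover have "rec_nat 0 (\<lambda>k y. if even k then y else Suc y) m = m div 2" for m :: nat
    by (induction m) auto
  ultimately show ?thesis by simp
qed

section \<open>Composition of machines\<close>

primrec oracle_subst :: "prog \<Rightarrow> prog \<Rightarrow> prog" where
  "oracle_subst h Zero = Zero"
| "oracle_subst h Succ = Succ"
| "oracle_subst h Query = h"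
| "oracle_subst h (Proj i) = Proj i"
| "oracle_subst h (Comp f gs) = Comp (oracle_subst h f) (map (oracle_subst h) gs)"
| "oracle_subst h (PRec f g) = PRec (oracle_subst h f) (oracle_subst h g)"
| "oracle_subst h (Mu f) = Mu (oracle_subst h f)"

lemma eval_oracle_subst:
  assumes "eval q f xs y" "\<And>n. eval r h [n] (q n)"
  shows "eval r (oracle_subst h f) xs y"
  using assms(1)
proof (induction rule: eval.induct)
  case (eval_Comp ys gs xs f z)
  then show ?case by (auto intro!: eval.eval_Comp[of ys])
next
  case (eval_Mu f n xs)
  then show ?case by (auto intro!: eval.eval_Mu)
qed (auto intro: eval.intros assms(2))

text \<open>Substituting a program for every oracle query composes two machines. This is how the
  machines given by the hypotheses become functions of the original oracle.\<close>

lemma computable_on_machine: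
  assumes "computable_on D H" "\<And>r. r \<in> D \<Longrightarrow> machine_fun f (H r) (Q r)"
  shows "computable_on D Q"
proof -
  obtain h where "\<And>r n. r \<in> D \<Longrightarrow> eval r h [n] (H r n)"
    using assms(1) by (rule computable_onE) blast
  then have "eval r (oracle_subst h f) [n] (Q r n)" if "r \<in> D" for r n
    using assms(2)[OF that] that unfolding machine_fun_def by (blast intro: eval_oracle_subst)
  then show ?thesis by (rule computable_onI)
qed

section \<open>Disjoint refinements and retractions\<close>

definition ball_radius :: "nat \<Rightarrow> real" where
  "ball_radius n = real (Suc (pfst (psnd n))) / real (Suc (psnd (psnd n)))"

lemma ideal_ball_eq: "ideal_ball \<nu> n = ball (\<nu> (pfst n)) (ball_radius n)"
  by (simp add: ideal_ball_def pos_rat_num_def prod_decode_eq_pair ball_radius_def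
      of_rat_divide of_rat_add)

lemma ball_radius_pos: "ball_radius n > 0"
  by (simp add: ball_radius_def)

lemma small_ideal_ball_exists:
  assumes dense: "closure (range \<nu>) = UNIV" and "e > 0"
  shows "\<exists>n. x \<in> ideal_ball \<nu> n \<and> ball_radius n < e"
proof -
  obtain m where m: "inverse (real (Suc m)) < e"
    using reals_Archimedean[OF \<open>e > 0\<close>] by auto
  have "x \<in> closure (range \<nu>)" by (simp add: dense)
  then obtain i where i: "dist (\<nu> i) x < inverse (real (Suc m))"
    unfolding closure_approachable by (metis imageE inverse_positive_iff_positive of_nat_0_less_iff zero_less_Suc)
  \<comment> \<open>The radius code \<open>(0, m)\<close> means \<open>1 / Suc m\<close>, since
    codes of positive rationals add one to both parts.\<close>
  let ?n = "prod_encode (i, prod_encode (0, m))"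
  have "ball_radius ?n = inverse (real (Suc m))"
    by (simp add: ball_radius_def inverse_eq_divide)
  then show ?thesis using i m by (intro exI[of _ ?n]) (simp add: ideal_ball_eq)
qed

lemma ideal_ball_base:
  assumes dense: "closure (range \<nu>) = UNIV" and "open U" "x \<in> U"
  shows "\<exists>n. x \<in> ideal_ball \<nu> n \<and> ideal_ball \<nu> n \<subseteq> U"
proof -
  obtain e where e: "e > 0" "ball x e \<subseteq> U"
    using assms(2,3) open_contains_ball by blast
  then obtain n where n: "x \<in> ideal_ball \<nu> n" "ball_radius n < e / 2"
    using small_ideal_ball_exists[OF dense, of "e / 2"] by auto
  have "dist x y < e" if "dist (\<nu> (pfst n)) y < ball_radius n" for y
    using dist_triangle[of x y "\<nu> (pfst n)"] that n by (simp add: ideal_ball_eq dist_commute)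
  then have "ideal_ball \<nu> n \<subseteq> ball x e" by (auto simp: ideal_ball_eq)
  then show ?thesis using n e by blast
qed

text \<open>Halving the radii keeps the balls around points of different sets apart.\<close>

lemma disjoint_open_extension:
  fixes T :: "'i \<Rightarrow> 'a::metric_space set"
  assumes "\<And>i. openin (top_of_set A) (T i)" and disj: "\<And>i j. i \<noteq> j \<Longrightarrow> T i \<inter> T j = {}"
  obtains W where "\<And>i. open (W i)" "\<And>i. T i \<subseteq> W i" "\<And>i j. i \<noteq> j \<Longrightarrow> W i \<inter> W j = {}"
proof -
  have TA: "T i \<subseteq> A" and "\<forall>x\<in>T i. \<exists>e>0. ball x e \<inter> A \<subseteq> T i" for i
    using assms(1)[of i] unfolding openin_contains_ball by auto
  then have "\<forall>i x. \<exists>e. x \<in> T i \<longrightarrow> e > 0 \<and> ball x e \<inter> A \<subseteq> T i" by blast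
  then obtain e where e: "\<And>i x. x \<in> T i \<Longrightarrow> e i x > 0" "\<And>i x. x \<in> T i \<Longrightarrow> ball x (e i x) \<inter> A \<subseteq> T i"
    by metis
  define W where "W i = (\<Union>x\<in>T i. ball x (e i x / 2))" for i
  have close: "e i x \<le> dist x y" if "i \<noteq> j" "x \<in> T i" "y \<in> T j" for i j x y
  proof (rule ccontr)
    assume "\<not> e i x \<le> dist x y"
    then have "y \<in> ball x (e i x) \<inter> A" using that(3) TA[of j] by auto
    then show False using e(2)[OF that(2)] disj[OF that(1)] that(3) by blast
  qed
  show thesis
  proof
    show "W i \<inter> W j = {}" if "i \<noteq> j" for i j
    proof (rule ccontr)
      assume "W i \<inter> W j \<noteq> {}"
      then obtain z x y where "x \<in> T i" "y \<in> T j" "dist x z < e i x / 2" "dist y z < e j y / 2"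
        unfolding W_def by auto
      \<comment> \<open>The two halved radii add up to at most the larger full radius, so one of the
        two directions of \<open>close\<close> is violated.\<close>
      moreover have "dist x y \<le> dist x z + dist y z"
        by (metis dist_commute dist_triangle)
      ultimately show False
        using close[OF that, of x y] close[OF not_sym[OF that], of y x] by (simp add: dist_commute)
    qed
  qed (use e in \<open>auto simp: W_def\<close>)
qed

text \<open>Dimension zero gives clopen subsets of \<open>A\<close>, and the countable base reduces
  them to a sequence. Removing earlier members makes it disjoint; grouping by the index of a
  containing \<open>V i\<close> and thickening gives the open sets.\<close>

lemma zero_dimensional_disjoint_refinement:
  fixes \<nu> :: "nat \<Rightarrow> 'a::metric_space" and V :: "nat \<Rightarrow> 'a set"
  assumes dense: "closure (range \<nu>) = UNIV" and dim: "top_of_set A dim_le 0"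
    and V: "\<And>i. open (V i)"
  obtains W where "\<And>i. open (W i)" "\<And>i. W i \<subseteq> V i" "(\<Union>i. W i) \<inter> A = (\<Union>i. V i) \<inter> A"
    "\<And>i j. i \<noteq> j \<Longrightarrow> W i \<inter> W j = {}"
proof -
  \<comment> \<open>Choosing at most one clopen set per ideal ball replaces a possibly uncountable
    family by a sequence.\<close>
  define good where "good n C i \<longleftrightarrow> openin (top_of_set A) C \<and> closedin (top_of_set A) C \<and>
    C \<subseteq> V i \<and> ideal_ball \<nu> n \<inter> A \<subseteq> C" for n C i
  have "\<exists>C i. openin (top_of_set A) C \<and> closedin (top_of_set A) C \<and> C \<subseteq> V i \<and>
    ((\<exists>D j. good n D j) \<longrightarrow> good n C i)" for n
  proof (cases "\<exists>D j. good n D j")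
    case True
    then show ?thesis unfolding good_def by blast
  next
    case False
    then show ?thesis by (intro exI[of _ "{}"]) auto
  qed
  then obtain C \<iota> where C: "\<And>n. openin (top_of_set A) (C n)" "\<And>n. closedin (top_of_set A) (C n)"
    "\<And>n. C n \<subseteq> V (\<iota> n)" and good: "\<And>n D j. good n D j \<Longrightarrow> good n (C n) (\<iota> n)"
    by metis
  have cover: "\<exists>n. x \<in> C n" if "x \<in> A" "x \<in> V i" for x i
  proof -
    have "openin (top_of_set A) (A \<inter> V i)" using V by (simp add: openin_open_Int)
    then obtain D D' where D: "openin (top_of_set A) D" "closedin (top_of_set A) D'" "openin (top_of_set A) D'"
        "x \<in> D" "D \<subseteq> D'" "D' \<subseteq> A \<inter> V i"
      using dim \<open>x \<in> A\<close> \<open>x \<in> V i\<close> unfolding dimension_le_0_neighbourhood_base_of_clopen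
      neighbourhood_base_of by (metis (no_types, lifting) IntI)
    then obtain U where U: "open U" "D' = A \<inter> U" unfolding openin_open by auto
    then obtain n where "x \<in> ideal_ball \<nu> n" "ideal_ball \<nu> n \<subseteq> U"
      using ideal_ball_base[OF dense U(1)] D by blast
    moreover then have "good n D' i" unfolding good_def using D U by blast
    ultimately show ?thesis using good[of n D' i] \<open>x \<in> A\<close> unfolding good_def by blast
  qed
  \<comment> \<open>As the \<open>C m\<close> are clopen in \<open>A\<close>, removing finitely many
    of them leaves a set open in \<open>A\<close>.\<close>
  define U where "U n = C n - (\<Union>m<n. C m)" for n
  define T where "T i = (\<Union>n\<in>{n. \<iota> n = i}. U n)" for i
  have "openin (top_of_set A) (U n)" for n
    unfolding U_def by (intro openin_diff C closedin_Union) (auto intro: C)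
  then have T: "openin (top_of_set A) (T i)" for i
    unfolding T_def by auto
  have U_disj: "m = n" if "x \<in> U m" "x \<in> U n" for x m n
    using that unfolding U_def by (metis DiffE UN_I lessThan_iff linorder_neqE_nat)
  have "T i \<inter> T j = {}" if "i \<noteq> j" for i j
    using that U_disj unfolding T_def by blast
  then obtain W where W: "\<And>i. open (W i)" "\<And>i. T i \<subseteq> W i" "\<And>i j. i \<noteq> j \<Longrightarrow> W i \<inter> W j = {}"
    using disjoint_open_extension[of A T] T by blast
  show thesis
  \<comment> \<open>The disjoint extension may leave \<open>V i\<close>; the intersection restores
    the inclusion and still contains \<open>T i\<close>.\<close>
  proof (rule that[of "\<lambda>i. W i \<inter> V i"])
    have "\<exists>j. x \<in> W j \<inter> V j" if "x \<in> A" "x \<in> V i" for x i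
    proof -
      define n where "n = (LEAST n. x \<in> C n)"
      have "x \<in> C n" unfolding n_def using cover[OF that] by (rule LeastI_ex)
      moreover then have "x \<in> U n" unfolding U_def n_def using not_less_Least by auto
      ultimately show ?thesis using W(2)[of "\<iota> n"] C(3)[of n] unfolding T_def by blast
    qed
    then show "(\<Union>i. W i \<inter> V i) \<inter> A = (\<Union>i. V i) \<inter> A" by blast
    show "(W i \<inter> V i) \<inter> (W j \<inter> V j) = {}" if "i \<noteq> j" for i j
      using W(3)[OF that] by blast
  qed (use V W in auto)
qed

section \<open>Distance estimates for balls away from \<open>B\<close>\<close>

lemma infdist_less_obtains:
  assumes "B \<noteq> {}" "infdist x B < t"
  obtains b where "b \<in> B" "dist x b < t"
  using assms unfolding infdist_def by (auto simp: cINF_less_iff)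

text \<open>For a radius \<open>R < infdist x B / 3\<close> the centre is within \<open>R\<close> of
  \<open>x\<close>, hence farther than \<open>3 * R - R\<close> from \<open>B\<close>.\<close>

lemma ideal_ball_far_cover:
  assumes "closure (range \<nu>) = UNIV" "closed B" "B \<noteq> {}" "x \<notin> B"
  obtains n where "x \<in> ideal_ball \<nu> n" "2 * ball_radius n < infdist (\<nu> (pfst n)) B"
proof -
  have "infdist x B > 0"
    using assms infdist_pos_not_in_closed by blast
  then obtain n where n: "x \<in> ideal_ball \<nu> n" "ball_radius n < infdist x B / 3"
    using small_ideal_ball_exists[OF assms(1), of "infdist x B / 3"] by auto
  with infdist_triangle[of x B "\<nu> (pfst n)"] show thesis
    by (intro that) (auto simp: ideal_ball_eq dist_commute)
qed

text \<open>Let \<open>d = infdist c B\<close>. Since \<open>R \<le> d / 2\<close>, the distance of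
  \<open>y\<close> from \<open>B\<close> is at least \<open>d / 2\<close>, while
  \<open>dist b y \<le> 2 * d + d / 2\<close>; the quotient of these bounds is 5.\<close>

lemma dist_le_infdist_in_far_ball:
  assumes "y \<in> ball c R" "2 * R \<le> infdist c B" "dist c b < 2 * infdist c B"
  shows "dist b y \<le> 5 * infdist y B" "y \<notin> B"
proof -
  have y: "dist c y < R" using assms(1) by simp
  have "infdist c B \<le> infdist y B + dist c y" by (rule infdist_triangle)
  moreover have "dist b y \<le> dist c b + dist c y" by (metis dist_commute dist_triangle)
  ultimately show "dist b y \<le> 5 * infdist y B" using y assms(2,3) by linarith
  show "y \<notin> B"
  proof
    assume "y \<in> B"
    then have "infdist c B \<le> dist c y" by (rule infdist_le)
    then show False using y assms(2) infdist_nonneg[of c B] zero_le_dist[of c y] by linarith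
  qed
qed

section \<open>Retractions glued from the identity and constant pieces\<close>

definition glued_retraction :: "'a set \<Rightarrow> 'a set \<Rightarrow> (nat \<Rightarrow> 'a set) \<Rightarrow> (nat \<Rightarrow> 'a) \<Rightarrow> ('a \<rightharpoonup> 'a)" where
  "glued_retraction A B W b = (\<lambda>x. if x \<in> B then Some x
     else if x \<in> A then Some (b (THE i. x \<in> W i)) else None)"

text \<open>The locale serves both the mere existence of a retraction and its computation. The
  condition on \<open>b i\<close> is limited to nonempty \<open>W i\<close> because in the existence
  proof the other indices may carry an arbitrary point.\<close>

locale gluing =
  fixes A B :: "'a::metric_space set" and W :: "nat \<Rightarrow> 'a set" and b :: "nat \<Rightarrow> 'a" and K :: real
  assumes closed: "closed A" "closed B" and subset: "B \<subseteq> A"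
    and open_W: "\<And>i. open (W i)" and disjoint: "\<And>i j. i \<noteq> j \<Longrightarrow> W i \<inter> W j = {}"
    and cover: "A - B \<subseteq> (\<Union>i. W i)" and W_B: "\<And>i. W i \<inter> B = {}"
    and b_B: "\<And>i. W i \<noteq> {} \<Longrightarrow> b i \<in> B"
    and K: "K \<ge> 0" "\<And>i y. y \<in> W i \<Longrightarrow> dist (b i) y \<le> K * infdist y B"
begin

abbreviation "f \<equiv> glued_retraction A B W b"

lemma retraction_W: "x \<in> A \<Longrightarrow> x \<in> W i \<Longrightarrow> f x = Some (b i)"
proof -
  assume "x \<in> A" "x \<in> W i"
  moreover have "(THE i. x \<in> W i) = i"
    using disjoint \<open>x \<in> W i\<close> by (intro the_equality) auto
  ultimately show ?thesis using W_B unfolding glued_retraction_def by auto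
qed

lemma retraction_B: "x \<in> B \<Longrightarrow> f x = Some x"
  by (simp add: glued_retraction_def)

lemma retraction_cases:
  assumes "x \<in> A"
  obtains "x \<in> B" "f x = Some x" | i where "x \<in> W i" "f x = Some (b i)" "b i \<in> B"
  using assms retraction_B retraction_W b_B cover by blast

lemma dom_retraction: "dom f = A"
  using subset unfolding glued_retraction_def by (auto split: if_splits)

lemma ran_retraction: "ran f = B"
proof
  show "ran f \<subseteq> B"
  proof
    fix y assume "y \<in> ran f"
    then obtain x where "f x = Some y" unfolding ran_def by auto
    moreover then have "x \<in> A" using dom_retraction by auto
    ultimately show "y \<in> B" by (auto elim: retraction_cases)
  qed
  show "B \<subseteq> ran f" by (auto intro: ranI retraction_B)
qed

text \<open>This bound yields continuity at points of \<open>B\<close> and later allows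
  \<open>x\<close> itself to approximate \<open>f x\<close> near \<open>B\<close>.\<close>

lemma dist_retraction: "x \<in> A \<Longrightarrow> dist (the (f x)) x \<le> K * infdist x B"
  by (erule retraction_cases) (auto intro: K mult_nonneg_nonneg)

lemma continuous_retraction: "continuous_on A (\<lambda>x. the (f x))"
  unfolding continuous_on_iff
proof (intro ballI allI impI)
  fix x e assume "x \<in> A" "e > (0::real)"
  show "\<exists>d>0. \<forall>y\<in>A. dist y x < d \<longrightarrow> dist (the (f y)) (the (f x)) < e"
    using \<open>x \<in> A\<close>
  proof (cases rule: retraction_cases)
    case 1
    \<comment> \<open>In the modulus \<open>e / (K + 1)\<close>, \<open>K\<close> pays for the
      distance from \<open>f y\<close> to \<open>y\<close> and 1 for that from \<open>y\<close> to
      \<open>x\<close>.\<close>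
    have "dist (the (f y)) x < e" if "y \<in> A" "dist y x < e / (K + 1)" for y
    proof -
      have "dist (the (f y)) x \<le> dist (the (f y)) y + dist y x" by (rule dist_triangle)
      also have "\<dots> \<le> K * dist y x + dist y x"
        using dist_retraction[OF that(1)] mult_left_mono[OF infdist_le[OF 1(1), of y] K(1)] by simp
      also have "\<dots> = (K + 1) * dist y x" by (simp add: algebra_simps)
      also have "\<dots> < e" using that(2) K(1) by (simp add: field_simps)
      finally show ?thesis .
    qed
    then show ?thesis using \<open>e > 0\<close> K(1) 1 by (intro exI[of _ "e / (K + 1)"]) auto
  next
    case (2 i)
    then obtain d where d: "d > 0" "ball x d \<subseteq> W i"
      using open_W open_contains_ball by blast
    \<comment> \<open>On \<open>A \<inter> W i\<close> the map is constant.\<close>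
    have "the (f y) = the (f x)" if "y \<in> A" "dist y x < d" for y
      using retraction_W[of y i] d that 2 by (auto simp: dist_commute)
    then show ?thesis using d(1) \<open>e > 0\<close> by (intro exI[of _ d]) auto
  qed
qed

lemma retraction_in_E_retract:
  "A \<in> \<Y> \<Longrightarrow> B \<noteq> {} \<Longrightarrow> B \<noteq> UNIV \<Longrightarrow> f \<in> E_retract \<Y> (A, B)"
  using closed subset continuous_retraction ran_retraction retraction_B
  by (auto simp: E_retract_def pairs_F_def cont_closed_dom_def dom_retraction)

end

text \<open>The same construction without computability, for pairs of which no name is given; it
  settles the domain of the operation.\<close>

lemma E_retract_nonempty:
  fixes \<nu> :: "nat \<Rightarrow> 'a::metric_space" and A B :: "'a set"
  assumes dense: "closure (range \<nu>) = UNIV" and dim: "top_of_set A dim_le 0"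
    and "closed A" "closed B" "B \<subseteq> A" "B \<noteq> {}" "B \<noteq> UNIV" "A \<in> \<Y>"
  shows "E_retract \<Y> (A, B) \<noteq> {}"
proof -
  define V where "V n = (if 2 * ball_radius n < infdist (\<nu> (pfst n)) B then ideal_ball \<nu> n else {})" for n
  have "open (V n)" for n by (simp add: V_def ideal_ball_eq)
  then obtain W where W: "\<And>i. open (W i)" "\<And>i. W i \<subseteq> V i" "(\<Union>i. W i) \<inter> A = (\<Union>i. V i) \<inter> A"
    "\<And>i j. i \<noteq> j \<Longrightarrow> W i \<inter> W j = {}"
    by (rule zero_dimensional_disjoint_refinement[OF dense dim, of V]) blast
  \<comment> \<open>A centre in \<open>B\<close> admits no point with the strict inequality, so
    \<open>b n\<close> stays arbitrary there.\<close>
  have "\<exists>b. infdist (\<nu> (pfst n)) B > 0 \<longrightarrow> b \<in> B \<and> dist (\<nu> (pfst n)) b < 2 * infdist (\<nu> (pfst n)) B" for n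
    using infdist_less_obtains[OF \<open>B \<noteq> {}\<close>, of "\<nu> (pfst n)" "2 * infdist (\<nu> (pfst n)) B"] by auto
  then obtain b where b: "\<And>n. infdist (\<nu> (pfst n)) B > 0 \<Longrightarrow>
      b n \<in> B \<and> dist (\<nu> (pfst n)) (b n) < 2 * infdist (\<nu> (pfst n)) B"
    by metis
  have V: "y \<notin> B" "b n \<in> B" "dist (b n) y \<le> 5 * infdist y B" if "y \<in> V n" for n y
  proof -
    have n: "2 * ball_radius n < infdist (\<nu> (pfst n)) B" "y \<in> ball (\<nu> (pfst n)) (ball_radius n)"
      using that unfolding V_def by (auto simp: ideal_ball_eq split: if_splits)
    then have "infdist (\<nu> (pfst n)) B > 0" using ball_radius_pos[of n] by linarith
    note b = b[OF this]
    then show "b n \<in> B" ..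
    show "y \<notin> B" "dist (b n) y \<le> 5 * infdist y B"
      using dist_le_infdist_in_far_ball[OF n(2) less_imp_le[OF n(1)]] b by blast+
  qed
  have "\<exists>n. x \<in> V n" if "x \<notin> B" for x
    by (rule ideal_ball_far_cover[OF dense \<open>closed B\<close> \<open>B \<noteq> {}\<close> that]) (auto simp: V_def)
  then have "A - B \<subseteq> (\<Union>i. W i)" using W(3) by blast
  moreover have WV: "y \<in> V i" if "y \<in> W i" for i y using W(2) that by blast
  moreover have "b i \<in> B" if ne: "W i \<noteq> {}" for i
  proof -
    obtain y where "y \<in> W i" using ne by blast
    then show ?thesis by (intro V(2) WV)
  qed
  moreover have "W i \<inter> B = {}" for i using V(1) WV by blast
  ultimately interpret gluing A B W b 5
    using W(4) by unfold_locales (simp_all add: assms W(1) V(3))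
  show ?thesis using retraction_in_E_retract[OF \<open>A \<in> \<Y>\<close> \<open>B \<noteq> {}\<close> \<open>B \<noteq> UNIV\<close>] by auto
qed

section \<open>Verifying upper bounds on distances\<close>

text \<open>\<open>int_decode\<close> halves even codes and sends odd codes to negative integers, so
  this is the numerator of the rational cut off at 0; the bounds compared later are
  nonnegative.\<close>

definition rat_numer :: "nat \<Rightarrow> nat" where
  "rat_numer m = (if even (pfst m) then pfst m div 2 else 0)"

definition rat_denom :: "nat \<Rightarrow> nat" where
  "rat_denom m = Suc (psnd m)"

lemma rat_numer_denom: "real (rat_numer m) / real (rat_denom m) = max 0 (of_rat (rat_num m))"
proof -
  have *: "rat_num m = of_int (int_decode (pfst m)) / of_nat (Suc (psnd m))"
    by (simp add: rat_num_def prod_decode_eq_pair)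
  have "of_rat (rat_num m) = real_of_int (int_decode (pfst m)) / real (Suc (psnd m))"
    unfolding * of_rat_divide of_rat_of_int_eq of_rat_of_nat_eq ..
  moreover have "max 0 (real_of_int (int_decode k) / real (Suc d)) =
      real (if even k then k div 2 else 0) / real (Suc d)" for k d
  proof (cases "even k")
    case False
    have "(- real (k div 2) - 1) / real (Suc d) \<le> 0" by (intro divide_nonpos_pos) auto
    then show ?thesis using False by (simp add: int_decode_def sum_decode_def)
  qed (simp add: int_decode_def sum_decode_def)
  ultimately show ?thesis
    unfolding rat_numer_def rat_denom_def by simp
qed

lemma computable_on_rat_numer [computable]:
  "computable_on D F \<Longrightarrow> computable_on D (\<lambda>r n. rat_numer (F r n))"
  unfolding rat_numer_def by (intro computable)

lemma computable_on_rat_denom [computable]: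
  "computable_on D F \<Longrightarrow> computable_on D (\<lambda>r n. rat_denom (F r n))"
  unfolding rat_denom_def by (intro computable)

section \<open>Cauchy names and their precision\<close>

lemma cauchy_rep_dist:
  assumes "cauchy_rep \<nu> p x"
  shows "dist (\<nu> (p i)) x \<le> (1/2) ^ i"
proof (rule tendsto_upperbound)
  show "(\<lambda>j. dist (\<nu> (p i)) (\<nu> (p j))) \<longlonglongrightarrow> dist (\<nu> (p i)) x"
    using assms unfolding cauchy_rep_def by (intro tendsto_intros) auto
  show "\<forall>\<^sub>F j in sequentially. dist (\<nu> (p i)) (\<nu> (p j)) \<le> (1/2) ^ i"
    using eventually_gt_at_top[of i]
    by eventually_elim (use assms in \<open>auto simp: cauchy_rep_def intro: less_imp_le\<close>)
qed simp

lemma cauchy_rep_const: "cauchy_rep \<nu> (\<lambda>_. i) (\<nu> i)"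
  by (simp add: cauchy_rep_def)

text \<open>Two entries from \<open>i\<close> onwards differ by at most
  \<open>2 * (1/2) ^ (i + 2)\<close>, which is less than \<open>(1/2) ^ i\<close>; hence the shift
  by 2.\<close>

lemma cauchy_repI:
  assumes "\<And>i. dist (\<nu> (p i)) x \<le> (1/2) ^ (i + 2)"
  shows "cauchy_rep \<nu> p x"
  unfolding cauchy_rep_def
proof (intro conjI allI impI)
  fix i j :: nat assume "i < j"
  have "dist (\<nu> (p i)) (\<nu> (p j)) \<le> dist (\<nu> (p i)) x + dist (\<nu> (p j)) x"
    by (metis dist_commute dist_triangle)
  also have "\<dots> \<le> (1/2) ^ (i + 2) + (1/2) ^ (j + 2)"
    by (intro add_mono assms)
  also have "\<dots> \<le> (1/2) ^ (i + 2) + (1/2) ^ (i + 2)"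
    using \<open>i < j\<close> by (intro add_left_mono power_decreasing) auto
  also have "\<dots> < (1/2) ^ i" by simp
  finally show "dist (\<nu> (p i)) (\<nu> (p j)) < (1/2) ^ i" .
next
  have lim: "(\<lambda>i. (1/2::real) ^ (i + 2)) \<longlonglongrightarrow> 0"
    using LIMSEQ_realpow_zero[of "1/2::real"] by (intro LIMSEQ_ignore_initial_segment) auto
  have "(\<lambda>i. dist (\<nu> (p i)) x) \<longlonglongrightarrow> 0"
    by (rule tendsto_sandwich[OF _ _ tendsto_const lim]) (use assms in auto)
  then show "(\<lambda>i. \<nu> (p i)) \<longlonglongrightarrow> x"
    by (rule tendsto_dist_iff[THEN iffD2])
qed

locale metric_approximation =
  fixes \<nu> :: "nat \<Rightarrow> 'a::metric_space" and approx :: "nat \<Rightarrow> nat \<Rightarrow> nat \<Rightarrow> nat" and approx_prog :: prog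
  assumes dense: "closure (range \<nu>) = UNIV"
    and approx_prog: "eval (\<lambda>_. 0) approx_prog [i, j, k] (approx i j k)"
    and approx: "\<bar>of_rat (rat_num (approx i j k)) - dist (\<nu> i) (\<nu> j)\<bar> \<le> (1/2) ^ k"
begin

text \<open>\<open>approx_prog\<close> runs with the zero oracle; replacing its queries by
  \<open>Zero\<close> makes it work under every oracle.\<close>

lemma computable_on_approx [computable]:
  assumes "computable_on D F" "computable_on D G" "computable_on D H"
  shows "computable_on D (\<lambda>r n. approx (F r n) (G r n) (H r n))"
  using approx_prog
  by (intro computable_on_comp3[OF eval_oracle_subst[of "\<lambda>_. 0" _ _ _ _ Zero] assms] eval_Zero)

text \<open>When \<open>i\<close> and \<open>j\<close> are the \<open>l\<close>-th entries of names of two points, \<open>close i j l a b\<close> certifies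
  that the distance of the points is less than \<open>a / b\<close>: it says that the approximate distance
  of \<open>\<nu> i\<close> and \<open>\<nu> j\<close> plus three times the error bound \<open>(1/2) ^ l\<close> is less than \<open>a / b\<close>.\<close>

definition close :: "nat \<Rightarrow> nat \<Rightarrow> nat \<Rightarrow> nat \<Rightarrow> nat \<Rightarrow> bool" where
  "close i j l a b \<longleftrightarrow> (let m = approx i j l in
     rat_numer m * 2 ^ l * b + 3 * rat_denom m * b < a * rat_denom m * 2 ^ l)"

lemma decidable_on_close [computable]:
  "computable_on D I \<Longrightarrow> computable_on D J \<Longrightarrow> computable_on D L \<Longrightarrow> computable_on D F \<Longrightarrow>
    computable_on D G \<Longrightarrow> decidable_on D (\<lambda>r n. close (I r n) (J r n) (L r n) (F r n) (G r n))"
  unfolding close_def Let_def by (intro computable)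

lemma close_iff:
  assumes "b > 0"
  shows "close i j l a b \<longleftrightarrow> max 0 (of_rat (rat_num (approx i j l))) + 3 * (1/2) ^ l < real a / real b"
proof -
  let ?m = "approx i j l"
  have pos: "real (rat_denom ?m) > 0" "real b > 0" "(2::real) ^ l > 0"
    using assms by (auto simp: rat_denom_def)
  have "n / d + 3 * (1 / t) < x / y \<longleftrightarrow> n * t * y + 3 * d * y < x * d * t"
    if "d > 0" "y > 0" "t > 0" for n d t x y :: real
    using that by (simp add: field_simps)
  from this[OF pos]
  have "max 0 (of_rat (rat_num ?m)) + 3 * (1/2) ^ l < real a / real b \<longleftrightarrow>
    real (rat_numer ?m) * 2 ^ l * real b + 3 * real (rat_denom ?m) * real b < real a * real (rat_denom ?m) * 2 ^ l"
    unfolding rat_numer_denom[symmetric] power_one_over .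
  also have "\<dots> \<longleftrightarrow> close i j l a b"
    unfolding close_def Let_def
    by (simp only: of_nat_less_iff[where ?'a = real, symmetric] of_nat_add of_nat_mult of_nat_power of_nat_numeral)
  finally show ?thesis ..
qed

text \<open>Passing from the points to their entries costs \<open>(1/2) ^ l\<close> for each, and
  \<open>approx\<close> costs it once more: the three errors that the certificate adds.\<close>

lemma close_sound:
  assumes "close (p l) (q l) l a b" "b > 0" "cauchy_rep \<nu> p x" "cauchy_rep \<nu> q y"
  shows "dist x y < real a / real b"
proof -
  define u m c where defs: "u = (1/2::real) ^ l" "m = real_of_rat (rat_num (approx (p l) (q l) l))"
    "c = real a / real b"
  have "dist (\<nu> (p l)) x \<le> u" "dist (\<nu> (q l)) y \<le> u" "\<bar>m - dist (\<nu> (p l)) (\<nu> (q l))\<bar> \<le> u"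
    "max 0 m + 3 * u < c"
    using cauchy_rep_dist[OF assms(3)] cauchy_rep_dist[OF assms(4)] approx assms(1)
    unfolding close_iff[OF assms(2)] defs by blast+
  moreover have "dist x y \<le> dist (\<nu> (p l)) x + dist (\<nu> (p l)) (\<nu> (q l)) + dist (\<nu> (q l)) y"
    by metric
  ultimately have "dist x y < c" by linarith
  then show ?thesis by (simp add: defs)
qed

lemma close_complete:
  assumes "dist x y < real a / real b" "b > 0" "cauchy_rep \<nu> p x" "cauchy_rep \<nu> q y"
  shows "\<exists>l\<ge>N. close (p l) (q l) l a b"
proof -
  define c where "c = real a / real b"
  \<comment> \<open>The tested quantity exceeds \<open>dist x y\<close> by at most six error terms:
    three from the approximation and three added by the certificate.\<close>
  have "(c - dist x y) / 6 > 0" using assms(1) by (simp add: c_def)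
  then obtain L where L: "(1/2::real) ^ L < (c - dist x y) / 6"
    using real_arch_pow_inv[of "(c - dist x y) / 6" "1/2"] by auto
  define l where "l = max L N"
  define u m where defs: "u = (1/2::real) ^ l" "m = real_of_rat (rat_num (approx (p l) (q l) l))"
  have "u \<le> (1/2) ^ L" unfolding l_def defs by (intro power_decreasing) auto
  then have u: "u < (c - dist x y) / 6" using L by (rule order_le_less_trans)
  have "dist (\<nu> (p l)) x \<le> u" "dist (\<nu> (q l)) y \<le> u" "\<bar>m - dist (\<nu> (p l)) (\<nu> (q l))\<bar> \<le> u"
    using cauchy_rep_dist[OF assms(3)] cauchy_rep_dist[OF assms(4)] approx unfolding defs by blast+
  moreover have "dist (\<nu> (p l)) (\<nu> (q l)) \<le> dist (\<nu> (p l)) x + dist x y + dist (\<nu> (q l)) y"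
    by metric
  ultimately have "m \<le> dist x y + 3 * u" by linarith
  moreover have "0 < u" by (simp add: defs)
  ultimately have "max 0 m \<le> dist x y + 3 * u" by simp
  moreover have "6 * u < c - dist x y" using u by simp
  ultimately have "max 0 m + 3 * u < c" by linarith
  then show ?thesis
    using close_iff[OF assms(2)] l_def unfolding defs c_def by (intro exI[of _ l]) auto
qed

end

section \<open>Computing the retraction\<close>

lemma computable_on_baire_fst [computable]:
  assumes "computable_on D p" "computable_on D F"
  shows "computable_on D (\<lambda>r n. baire_fst (p r) (F r n))"
  unfolding baire_fst_def
  by (rule computable_on_subst[OF assms(1)]) (intro computable assms)

lemma computable_on_baire_snd [computable]:
  assumes "computable_on D p" "computable_on D F"
  shows "computable_on D (\<lambda>r n. baire_snd (p r) (F r n))"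
  unfolding baire_snd_def
  by (rule computable_on_subst[OF assms(1)]) (intro computable assms)

lemma computable_on_oracle_id: "computable_on D (\<lambda>r. r)"
  using computable_on_oracle[OF computable_on_id] by simp

text \<open>Such lists are prefixes of the constant name of an ideal point, on which the associate
  of the distance function is queried.\<close>

lemma computable_on_replicate [computable]:
  assumes "computable_on D F" "computable_on D G"
  shows "computable_on D (\<lambda>r n. list_encode (replicate (F r n) (G r n)))"
proof -
  have "rec_nat 0 (\<lambda>_ y. Suc (prod_encode (x, y))) k = list_encode (replicate k x)" for x k
    by (induction k) auto
  moreover have "computable_on D (\<lambda>r n. rec_nat 0 (\<lambda>_ y. Suc (prod_encode (G r n, y))) (F r n))"
    by (intro computable assms computable_on_subst[OF assms(2)])
  ultimately show ?thesis by simp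
qed

text \<open>Past the end the value stays 0, the code of the empty list, so a nonzero value certifies
  that position \<open>i\<close> exists.\<close>

definition list_drop :: "nat \<Rightarrow> nat \<Rightarrow> nat" where
  "list_drop w i = rec_nat w (\<lambda>_ y. psnd (y - 1)) i"

definition list_nth :: "nat \<Rightarrow> nat \<Rightarrow> nat" where
  "list_nth w i = pfst (list_drop w i - 1)"

lemma computable_on_list_drop [computable]:
  "computable_on D F \<Longrightarrow> computable_on D G \<Longrightarrow> computable_on D (\<lambda>r n. list_drop (F r n) (G r n))"
  unfolding list_drop_def by (intro computable)

lemma computable_on_list_nth [computable]:
  "computable_on D F \<Longrightarrow> computable_on D G \<Longrightarrow> computable_on D (\<lambda>r n. list_nth (F r n) (G r n))"
  unfolding list_nth_def by (intro computable)

lemma list_drop_encode: "list_drop (list_encode xs) i = list_encode (drop i xs)"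
proof (induction i)
  case (Suc i)
  have "psnd (list_encode ys - 1) = list_encode (tl ys)" for ys
  proof (cases ys)
    case Nil
    have "prod_encode (0, 0) = 0" by (simp add: prod_encode_def)
    then show ?thesis using psnd_encode[of 0 0] Nil by simp
  qed simp
  then show ?case using Suc by (simp add: list_drop_def drop_Suc tl_drop)
qed (simp add: list_drop_def)

lemma list_encode_eq_0: "list_encode xs = 0 \<longleftrightarrow> xs = []"
  by (cases xs) auto

lemma list_nth_encode: "i < length xs \<Longrightarrow> list_nth (list_encode xs) i = xs ! i"
  by (simp add: list_nth_def list_drop_encode Cons_nth_drop_Suc[symmetric])

text \<open>Hence the code of a prefix can bound a search: it grows without limit with the
  prefix.\<close>

lemma length_le_list_encode: "length xs \<le> list_encode xs"
  by (induction xs) (auto intro: le_trans[OF _ le_prod_encode_2])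

definition first_answer :: "nat \<Rightarrow> (nat \<Rightarrow> nat) \<Rightarrow> nat" where
  "first_answer N F = rec_nat 0 (\<lambda>s y. if y = 0 then F s else y) N"

lemma first_answer_eq_0: "first_answer N F = 0 \<longleftrightarrow> (\<forall>s<N. F s = 0)"
  unfolding first_answer_def by (induction N) (auto simp: less_Suc_eq)

lemma first_answer_nonzero: "first_answer N F \<noteq> 0 \<Longrightarrow> \<exists>s<N. F s = first_answer N F"
  unfolding first_answer_def by (induction N) (auto simp: less_Suc_eq split: if_splits)

lemma dist_fun_eq:
  assumes "B \<noteq> {}"
  shows "dist_fun B x = ereal (infdist x B)"
proof -
  have bdd: "bdd_below (dist x ` B)" by (intro bdd_belowI[of _ 0]) auto
  show ?thesis
    unfolding dist_fun_def infdist_def using assms bdd by (simp add: ereal_Inf' image_comp)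
qed

text \<open>The \<open>n\<close>-th value of the limit name is read off any prefix on which the associate answers.\<close>

lemma eta_cauchy_rep:
  assumes answer: "\<And>n. \<exists>k. a (prod_encode (n, list_encode (map p [0..<k]))) \<noteq> 0"
    and dist: "\<And>n k v. a (prod_encode (n, list_encode (map p [0..<k]))) = Suc v \<Longrightarrow>
      dist (\<nu> v) y \<le> (1/2) ^ (n + 2)"
  shows "\<exists>q. eta a p q \<and> cauchy_rep \<nu> q y"
proof -
  let ?a = "\<lambda>n k. a (prod_encode (n, list_encode (map p [0..<k])))"
  define k where "k n = (LEAST k. ?a n k \<noteq> 0)" for n
  define q where "q n = ?a n (k n) - 1" for n
  have q: "?a n (k n) = Suc (q n)" for n
    using LeastI_ex[OF answer[of n]] unfolding q_def k_def by simp
  have "\<forall>j<k n. ?a n j = 0" for n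
    unfolding k_def using not_less_Least by blast
  then have "eta a p q" unfolding eta_def using q by blast
  moreover have "cauchy_rep \<nu> q y" by (rule cauchy_repI) (rule dist[OF q])
  ultimately show ?thesis by blast
qed

context metric_approximation
begin

section \<open>Evidence contained in an input name, and the balls to be refined\<close>

definition point_name :: "baire \<Rightarrow> nat \<Rightarrow> baire" where
  "point_name r j = (\<lambda>l. baire_fst (baire_snd r) (prod_encode (j, l)))"

definition dist_name :: "baire \<Rightarrow> baire" where
  "dist_name r = baire_snd (baire_snd r)"

lemma computable_on_point_name [computable]:
  "computable_on D F \<Longrightarrow> computable_on D G \<Longrightarrow> computable_on D (\<lambda>r n. point_name r (F r n) (G r n))"
  unfolding point_name_def by (intro computable_on_oracle_id computable) 

lemma computable_on_dist_name [computable]: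
  "computable_on D F \<Longrightarrow> computable_on D (\<lambda>r n. dist_name r (F r n))"
  unfolding dist_name_def by (intro computable_on_oracle_id computable)

text \<open>An index \<open>\<langle>c, \<langle>e, \<langle>m, \<langle>k, \<langle>j, l\<rangle>\<rangle>\<rangle>\<rangle>\<rangle>\<close> names an ideal ball \<open>c\<close>, a point \<open>b j\<close>, and evidence: the
  associate of the distance function, queried for its \<open>m\<close>-th value at the centre, answers on the
  prefix of length \<open>k\<close> with the lower bound number \<open>e\<close>, which is at least twice the radius, and
  precision \<open>l\<close> shows that \<open>b j\<close> is closer to the centre than twice this bound.\<close>

definition index_point :: "nat \<Rightarrow> nat" where
  "index_point s = pfst (psnd (psnd (psnd (psnd s))))"

definition valid_index :: "baire \<Rightarrow> nat \<Rightarrow> bool" where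
  "valid_index r s \<longleftrightarrow> (let c = pfst s; e = pfst (psnd s); m = pfst (psnd (psnd s));
      k = pfst (psnd (psnd (psnd s))); l = psnd (psnd (psnd (psnd (psnd s)))) in
     dist_name r (prod_encode (m, list_encode (replicate k (pfst c)))) = Suc (Suc e) \<and>
     (\<forall>i<k. dist_name r (prod_encode (m, list_encode (replicate i (pfst c)))) = 0) \<and>
     2 * Suc (pfst (psnd c)) * rat_denom e \<le> rat_numer e * Suc (psnd (psnd c)) \<and>
     close (pfst c) (point_name r (index_point s) l) l (2 * rat_numer e) (rat_denom e))"

lemma computable_on_index_point [computable]:
  "computable_on D F \<Longrightarrow> computable_on D (\<lambda>r n. index_point (F r n))"
  unfolding index_point_def by (intro computable)

lemma decidable_on_valid_index: "decidable_on D valid_index"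
  unfolding valid_index_def Let_def by (intro computable)

definition far_ball :: "baire \<Rightarrow> nat \<Rightarrow> 'a set" where
  "far_ball r s = (if valid_index r s then ideal_ball \<nu> (pfst s) else {})"

text \<open>Position \<open>z\<close> codes \<open>(s, j)\<close>. The \<open>s\<close>-th name
  repeats one ball at every \<open>j\<close>, or consists of zeros and names the empty set.\<close>

definition far_ball_name :: "baire \<Rightarrow> baire" where
  "far_ball_name r z = (if valid_index r (pfst z) then Suc (pfst (pfst z)) else 0)"

lemma open_far_ball: "open (far_ball r s)"
  by (simp add: far_ball_def ideal_ball_eq)

lemma far_ball_name: "seq_rep (open_rep \<nu>) (far_ball_name r) (far_ball r)"
  by (auto simp: seq_rep_def open_rep_def baire_nth_def far_ball_name_def far_ball_def image_iff)

definition refinement_input :: "baire \<Rightarrow> baire" where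
  "refinement_input r n = (if even n then far_ball_name r (n div 2) else baire_fst r (n div 2))"

lemma refinement_input_parts:
  "baire_fst (refinement_input r) = far_ball_name r" "baire_snd (refinement_input r) = baire_fst r"
  by (auto simp: baire_fst_def baire_snd_def refinement_input_def)

lemma computable_on_refinement_input: "computable_on D refinement_input"
  unfolding refinement_input_def far_ball_name_def
  by (intro computable computable_on_oracle_id decidable_on_subst[OF decidable_on_valid_index])

section \<open>The associate of the retraction\<close>

text \<open>The number \<open>s\<close> is read in two ways. As \<open>(j, l)\<close> it asks
  whether precision \<open>l\<close> shows the point to be within \<open>(1/2) ^ (n + 6)\<close> of
  the \<open>j\<close>-th dense point; the answer is then an entry of the name of the point itself.
  As \<open>(i, (t, k))\<close> it asks whether precision \<open>k\<close> puts the point into the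
  ball at place \<open>t\<close> of the \<open>i\<close>-th refined set; the answer is then an entry
  of the name of the constant value there.\<close>

definition outcome :: "baire \<Rightarrow> baire \<Rightarrow> nat \<Rightarrow> nat \<Rightarrow> nat \<Rightarrow> nat" where
  "outcome r q n w s =
    (if list_drop w (psnd s) \<noteq> 0 \<and> list_drop w (n + 3) \<noteq> 0 \<and>
        close (list_nth w (psnd s)) (point_name r (pfst s) (psnd s)) (psnd s) 1 (2 ^ (n + 6))
     then Suc (list_nth w (n + 3))
     else let k = psnd (psnd s); c = q (prod_encode (pfst s, pfst (psnd s))) in
       if list_drop w k \<noteq> 0 \<and> c \<noteq> 0 \<and>
         close (list_nth w k) (pfst (c - 1)) k (Suc (pfst (psnd (c - 1)))) (Suc (psnd (psnd (c - 1))))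
       then Suc (point_name r (index_point (pfst s)) (n + 2))
       else 0)"

text \<open>The prefix code \<open>psnd z\<close> also bounds the search. Answers may vary with the
  prefix; it suffices that each is accurate.\<close>

definition retraction_associate :: "(baire \<Rightarrow> baire) \<Rightarrow> baire \<Rightarrow> baire" where
  "retraction_associate Q r z = first_answer (psnd z) (outcome r (Q r) (pfst z) (psnd z))"

lemma computable_on_retraction_associate:
  assumes "computable_on D Q"
  shows "computable_on D (retraction_associate Q)"
  unfolding retraction_associate_def outcome_def first_answer_def Let_def
  by (intro computable computable_on_subst[OF assms])

end

section \<open>Correctness for one fixed input name\<close>

locale retraction_names = metric_approximation \<nu> approx approx_prog
  for \<nu> :: "nat \<Rightarrow> 'a::metric_space" and approx approx_prog +
  fixes \<Y> :: "'a set set" and A B :: "'a set" and b :: "nat \<Rightarrow> 'a" and W :: "nat \<Rightarrow> 'a set"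
    and r :: baire and Q :: "baire \<Rightarrow> baire"
  assumes closed_A: "closed A" and closed_B: "closed B" and B_nonempty: "B \<noteq> {}" and B_A: "B \<subseteq> A"
    and point_name: "\<And>j. cauchy_rep \<nu> (point_name r j) (b j)"
    and range_b: "range b \<subseteq> B" and B_b: "B \<subseteq> closure (range b)"
    and dist_name: "realizer (eta (dist_name r)) (cauchy_rep \<nu>) lower_rep (\<lambda>x. {dist_fun B x})"
    and refinement: "W \<in> S_tilde \<Y> (far_ball r, A)"
    and refinement_name: "seq_rep (open_rep \<nu>) (Q r) W"
begin

lemma lower_bounds_name:
  obtains p where "eta (dist_name r) (\<lambda>_. i) p"
    "\<And>t. (\<exists>m e. p m = Suc e \<and> rat_num e = t) \<longleftrightarrow> of_rat t < infdist (\<nu> i) B"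
proof -
  obtain p where p: "eta (dist_name r) (\<lambda>_. i) p" "lower_rep p (dist_fun B (\<nu> i))"
    using dist_name cauchy_rep_const[of \<nu> i] unfolding realizer_def mv_dom_def by blast
  have "(\<exists>m e. p m = Suc e \<and> rat_num e = t) \<longleftrightarrow> t \<in> {rat_num n |n. Suc n \<in> range p}" for t
    by (auto simp: image_iff) metis+
  also have "\<dots> t \<longleftrightarrow> of_rat t < infdist (\<nu> i) B" for t
    using p(2) unfolding lower_rep_def dist_fun_eq[OF B_nonempty] by auto
  finally show thesis using p(1) that by blast
qed

lemma valid_index_sound:
  assumes "valid_index r s"
  defines "c \<equiv> \<nu> (pfst (pfst s))"
  shows "2 * ball_radius (pfst s) \<le> infdist c B" "dist c (b (index_point s)) < 2 * infdist c B"
proof -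
  define n e m k l where defs: "n = pfst s" "e = pfst (psnd s)" "m = pfst (psnd (psnd s))"
    "k = pfst (psnd (psnd (psnd s)))" "l = psnd (psnd (psnd (psnd (psnd s))))"
  let ?a = "\<lambda>k. dist_name r (prod_encode (m, list_encode (replicate k (pfst n))))"
  \<comment> \<open>One \<open>Suc\<close> comes from the answers of an associate, the other from
    the list entries in \<open>lower_rep\<close>.\<close>
  have a: "?a k = Suc (Suc e)" "\<forall>i<k. ?a i = 0"
    and radius: "2 * Suc (pfst (psnd n)) * rat_denom e \<le> rat_numer e * Suc (psnd (psnd n))"
    and cl: "close (pfst n) (point_name r (index_point s) l) l (2 * rat_numer e) (rat_denom e)"
    using assms(1) unfolding valid_index_def Let_def defs by auto
  obtain p where p: "eta (dist_name r) (\<lambda>_. pfst n) p"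
    "\<And>t. (\<exists>m e. p m = Suc e \<and> rat_num e = t) \<longleftrightarrow> of_rat t < infdist (\<nu> (pfst n)) B"
    by (rule lower_bounds_name[of "pfst n"]) blast
  from p(1) obtain k' where k': "?a k' = Suc (p m)" "\<forall>i<k'. ?a i = 0"
    unfolding eta_def map_replicate_const by auto
  \<comment> \<open>Both are the length of the first prefix on which the associate answers.\<close>
  have "k = k'" using a k' by (metis linorder_neqE_nat nat.distinct(1))
  then have lower: "of_rat (rat_num e) < infdist (\<nu> (pfst n)) B"
    using p(2)[of "rat_num e"] a(1) k'(1) by auto
  define t where "t = real (rat_numer e) / real (rat_denom e)"
  have denom: "real (rat_denom e) > 0" by (simp add: rat_denom_def)
  have "real (2 * Suc (pfst (psnd n)) * rat_denom e) \<le> real (rat_numer e * Suc (psnd (psnd n)))"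
    using radius by (rule of_nat_mono)
  then have "2 * ball_radius n \<le> t"
    unfolding ball_radius_def t_def using denom by (simp add: field_simps)
  moreover have "t = max 0 (of_rat (rat_num e))"
    unfolding t_def by (rule rat_numer_denom)
  \<comment> \<open>A positive radius makes \<open>t\<close> positive, so \<open>t\<close> is the
    rational itself and not the cut-off value 0.\<close>
  ultimately have t: "2 * ball_radius n \<le> t" "t < infdist (\<nu> (pfst n)) B"
    using lower ball_radius_pos[of n] by auto
  then show "2 * ball_radius (pfst s) \<le> infdist c B"
    unfolding c_def defs by simp
  have "dist (\<nu> (pfst n)) (b (index_point s)) < real (2 * rat_numer e) / real (rat_denom e)"
    using close_sound[where p = "\<lambda>_. pfst n", OF cl _ cauchy_rep_const point_name] denom by simp
  then have "dist (\<nu> (pfst n)) (b (index_point s)) < 2 * t" by (simp add: t_def)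
  then show "dist c (b (index_point s)) < 2 * infdist c B"
    using t(2) unfolding c_def defs by simp
qed

lemma dense_point_near:
  assumes "infdist x B < t"
  obtains j where "dist x (b j) < t"
proof -
  obtain y where y: "y \<in> B" "dist x y < t"
    using infdist_less_obtains[OF B_nonempty assms] .
  then have "y \<in> closure (range b)" "t - dist x y > 0" using B_b by auto
  then obtain j where "dist (b j) y < t - dist x y"
    unfolding closure_approachable by (metis imageE)
  then have "dist x (b j) < t" using dist_triangle[of x "b j" y] by (simp add: dist_commute)
  then show thesis by (rule that)
qed

lemma valid_index_complete:
  assumes "2 * ball_radius n < infdist (\<nu> (pfst n)) B"
  obtains s where "valid_index r s" "pfst s = n"
proof -
  let ?I = "infdist (\<nu> (pfst n)) B"
  have "?I > 0" using assms ball_radius_pos[of n] by linarith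
  \<comment> \<open>The bound \<open>3/4\<close> makes \<open>t\<close> positive and
    \<open>2 * t\<close> larger than the distance, so that some \<open>b j\<close> can be
    certified.\<close>
  then obtain t where t: "max (2 * ball_radius n) (3/4 * ?I) < of_rat t" "of_rat t < ?I"
    using of_rat_dense[of "max (2 * ball_radius n) (3/4 * ?I)" ?I] assms by auto
  obtain p where p: "eta (dist_name r) (\<lambda>_. pfst n) p"
    "\<And>t. (\<exists>m e. p m = Suc e \<and> rat_num e = t) \<longleftrightarrow> of_rat t < ?I"
    by (rule lower_bounds_name[of "pfst n"]) blast
  obtain m e where e: "p m = Suc e" "rat_num e = t" using p(2) t(2) by blast
  let ?a = "\<lambda>k. dist_name r (prod_encode (m, list_encode (replicate k (pfst n))))"
  obtain k where k: "?a k = Suc (Suc e)" "\<forall>i<k. ?a i = 0"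
    using p(1)[unfolded eta_def map_replicate_const length_upt minus_nat.diff_0] e(1) by metis
  have denom: "rat_denom e > 0" by (simp add: rat_denom_def)
  have t_eq: "of_rat t = real (rat_numer e) / real (rat_denom e)"
  proof -
    have "3/4 * ?I < real_of_rat t" using t(1) by simp
    then have "0 \<le> real_of_rat t" using \<open>?I > 0\<close> by linarith
    then show ?thesis using rat_numer_denom[of e] unfolding e(2) by (simp only: max_absorb2)
  qed
  have "?I < 2 * of_rat t" using t(1) \<open>?I > 0\<close> by simp
  then obtain j where "dist (\<nu> (pfst n)) (b j) < 2 * of_rat t"
    using dense_point_near by blast
  then have "dist (\<nu> (pfst n)) (b j) < real (2 * rat_numer e) / real (rat_denom e)"
    by (simp add: t_eq)
  from close_complete[OF this denom cauchy_rep_const point_name]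
  obtain l where l: "close (pfst n) (point_name r j l) l (2 * rat_numer e) (rat_denom e)" by blast
  have "2 * ball_radius n \<le> real (rat_numer e) / real (rat_denom e)"
    using t(1) unfolding t_eq by simp
  then have "real (2 * Suc (pfst (psnd n)) * rat_denom e) \<le> real (rat_numer e * Suc (psnd (psnd n)))"
    unfolding ball_radius_def using denom by (simp add: field_simps)
  then have "2 * Suc (pfst (psnd n)) * rat_denom e \<le> rat_numer e * Suc (psnd (psnd n))"
    by (rule of_nat_le_iff[THEN iffD1])
  with k l show thesis
    by (intro that[of "prod_encode (n, prod_encode (e, prod_encode (m, prod_encode (k, prod_encode (j, l)))))"])
      (simp_all only: valid_index_def index_point_def Let_def pfst_encode psnd_encode simp_thms)
qed

lemma refinement_properties:
  "open (W s)" "W s \<subseteq> far_ball r s" "(\<Union>s. W s) \<inter> A = (\<Union>s. far_ball r s) \<inter> A"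
  "s \<noteq> t \<Longrightarrow> W s \<inter> W t = {}"
  using refinement unfolding S_tilde_def by auto

lemma far_ball_properties:
  assumes "x \<in> far_ball r s"
  shows "dist (b (index_point s)) x \<le> 5 * infdist x B" "x \<notin> B"
proof -
  have s: "valid_index r s" "x \<in> ball (\<nu> (pfst (pfst s))) (ball_radius (pfst s))"
    using assms unfolding far_ball_def ideal_ball_eq by (auto split: if_splits)
  show "dist (b (index_point s)) x \<le> 5 * infdist x B" "x \<notin> B"
    using dist_le_infdist_in_far_ball[OF s(2) valid_index_sound[OF s(1)]] by blast+
qed

lemma far_ball_cover:
  assumes "x \<notin> B"
  shows "\<exists>s. x \<in> far_ball r s"
proof -
  obtain n where n: "x \<in> ideal_ball \<nu> n" "2 * ball_radius n < infdist (\<nu> (pfst n)) B"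
    by (rule ideal_ball_far_cover[OF dense closed_B B_nonempty assms])
  obtain s where "valid_index r s" "pfst s = n"
    by (rule valid_index_complete[OF n(2)])
  then show ?thesis using n(1) unfolding far_ball_def by auto
qed

sublocale gluing A B W "\<lambda>s. b (index_point s)" 5
proof
  show "A - B \<subseteq> (\<Union>s. W s)" using far_ball_cover refinement_properties(3) by blast
  show "W s \<inter> B = {}" for s using refinement_properties(2)[of s] far_ball_properties(2) by blast
  show "dist (b (index_point s)) y \<le> 5 * infdist y B" if "y \<in> W s" for s y
    using refinement_properties(2)[of s] far_ball_properties(1) that by blast
qed (use closed_A closed_B B_A range_b refinement_properties in auto)

lemma outcome_sound:
  assumes x: "x \<in> A" "cauchy_rep \<nu> p x" and out: "outcome r (Q r) n (list_encode (map p [0..<K])) s = Suc v"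
  shows "dist (\<nu> v) (the (f x)) \<le> (1/2) ^ (n + 2)"
proof -
  let ?w = "list_encode (map p [0..<K])"
  have drop: "i < K \<and> list_nth ?w i = p i" if "list_drop ?w i \<noteq> 0" for i
  proof -
    have "i < K" using that by (auto simp: list_drop_encode list_encode_eq_0)
    then show ?thesis by (simp add: list_nth_encode)
  qed
  let ?j = "pfst s" and ?l = "psnd s"
  consider "list_drop ?w ?l \<noteq> 0" "list_drop ?w (n + 3) \<noteq> 0"
      "close (list_nth ?w ?l) (point_name r ?j ?l) ?l 1 (2 ^ (n + 6))" "v = list_nth ?w (n + 3)"
    | k c where "list_drop ?w k \<noteq> 0" "Q r (prod_encode (pfst s, pfst (psnd s))) = Suc c"
      "close (list_nth ?w k) (pfst c) k (Suc (pfst (psnd c))) (Suc (psnd (psnd c)))"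
      "v = point_name r (index_point (pfst s)) (n + 2)"
    using out unfolding outcome_def Let_def by (auto split: if_splits simp: gr0_conv_Suc)
  then show ?thesis
  proof cases
    case 1
    have "close (p ?l) (point_name r ?j ?l) ?l 1 (2 ^ (n + 6))" using 1 drop by simp
    from close_sound[OF this _ x(2) point_name]
    have near: "dist x (b ?j) < (1/2) ^ (n + 6)" by (simp add: power_one_over)
    \<comment> \<open>The total error is at most \<open>u / 8 + 5 * u / 64\<close>, which is less
      than \<open>u / 4\<close>; this explains the precisions \<open>n + 3\<close> and
      \<open>n + 6\<close>.\<close>
    define u where "u = (1/2::real) ^ n"
    have u: "(1/2) ^ (n + 6) = u / 64" "(1/2) ^ (n + 3) = u / 8" "(1/2) ^ (n + 2) = u / 4" "u > 0"
      by (simp_all add: u_def power_add power_divide)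
    have "infdist x B \<le> dist x (b ?j)" using range_b by (intro infdist_le) auto
    moreover have "dist (the (f x)) x \<le> 5 * infdist x B" by (rule dist_retraction[OF x(1)])
    moreover have "dist (\<nu> v) x \<le> u / 8"
      using cauchy_rep_dist[OF x(2), of "n + 3"] 1 drop unfolding u by simp
    moreover have "dist (\<nu> v) (the (f x)) \<le> dist (\<nu> v) x + dist (the (f x)) x" by (rule dist_triangle2)
    ultimately show ?thesis using near u(4) unfolding u by linarith
  next
    case (2 k c)
    have "close (p k) (pfst c) k (Suc (pfst (psnd c))) (Suc (psnd (psnd c)))" using 2 drop by simp
    from close_sound[where q = "\<lambda>_. pfst c", OF this _ x(2) cauchy_rep_const]
    have "x \<in> ideal_ball \<nu> c" by (simp add: ideal_ball_eq ball_radius_def dist_commute)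
    moreover have "open_rep \<nu> (baire_nth (Q r) (pfst s)) (W (pfst s))"
      using refinement_name unfolding seq_rep_def by blast
    then have "ideal_ball \<nu> c \<subseteq> W (pfst s)"
      unfolding open_rep_def baire_nth_def using 2(2) by (auto simp: image_iff) metis
    ultimately have "f x = Some (b (index_point (pfst s)))"
      using retraction_W[OF x(1)] by blast
    then show ?thesis using cauchy_rep_dist[OF point_name, of "index_point (pfst s)" "n + 2"] 2 by simp
  qed
qed

text \<open>A point of \<open>B\<close> is close to some \<open>b j\<close>, and any other point of
  \<open>A\<close> lies in a ball listed for some \<open>W i\<close>; either fact is certified at a
  finite precision, and longer prefixes preserve the evidence.\<close>

lemma outcome_complete:
  assumes x: "x \<in> A" "cauchy_rep \<nu> p x"
  shows "\<exists>s M. \<forall>K\<ge>M. outcome r (Q r) n (list_encode (map p [0..<K])) s \<noteq> 0"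
proof -
  have drop: "list_drop (list_encode (map p [0..<K])) i \<noteq> 0"
    "list_nth (list_encode (map p [0..<K])) i = p i" if "i < K" for i K
    using that by (simp_all add: list_drop_encode list_encode_eq_0 list_nth_encode)
  from \<open>x \<in> A\<close> consider "x \<in> B" | i where "x \<in> W i" by (rule retraction_cases)
  then show ?thesis
  proof cases
    case 1
    then have "infdist x B < (1/2) ^ (n + 6)" by simp
    then obtain j where "dist x (b j) < (1/2) ^ (n + 6)" by (rule dense_point_near)
    then have "dist x (b j) < real 1 / real (2 ^ (n + 6))" by (simp add: power_one_over)
    from close_complete[OF this _ x(2) point_name]
    obtain l where "close (p l) (point_name r j l) l 1 (2 ^ (n + 6))" by auto
    then have "outcome r (Q r) n (list_encode (map p [0..<K])) (prod_encode (j, l)) \<noteq> 0"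
      if "K \<ge> Suc (l + n + 3)" for K
      using that unfolding outcome_def by (simp add: drop)
    then show ?thesis by blast
  next
    case 2
    have "open_rep \<nu> (baire_nth (Q r) i) (W i)"
      using refinement_name unfolding seq_rep_def by blast
    then obtain c t where c: "x \<in> ideal_ball \<nu> c" "Q r (prod_encode (i, t)) = Suc c"
      using 2 unfolding open_rep_def baire_nth_def by (auto simp: image_iff)
    then have "dist x (\<nu> (pfst c)) < real (Suc (pfst (psnd c))) / real (Suc (psnd (psnd c)))"
      by (simp add: ideal_ball_eq ball_radius_def dist_commute)
    from close_complete[OF this _ x(2) cauchy_rep_const]
    obtain k where "close (p k) (pfst c) k (Suc (pfst (psnd c))) (Suc (psnd (psnd c)))" by auto
    then have "outcome r (Q r) n (list_encode (map p [0..<K])) (prod_encode (i, prod_encode (t, k))) \<noteq> 0"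
      if "K \<ge> Suc k" for K
      using that c(2) unfolding outcome_def Let_def by (simp add: drop)
    then show ?thesis by blast
  qed
qed

lemma retraction_associate_realizer:
  "realizer (eta (retraction_associate Q r)) (cauchy_rep \<nu>) (cauchy_rep \<nu>) (\<lambda>x. set_option (f x))"
  unfolding realizer_def
proof (intro allI impI)
  fix p x assume px: "cauchy_rep \<nu> p x \<and> x \<in> mv_dom (\<lambda>x. set_option (f x))"
  then obtain y where "f x = Some y" unfolding mv_dom_def by auto
  then have x: "x \<in> A" "f x = Some (the (f x))" using dom_retraction by auto
  have "\<exists>q. eta (retraction_associate Q r) p q \<and> cauchy_rep \<nu> q (the (f x))"
  proof (rule eta_cauchy_rep)
    fix n
    obtain s M where s: "\<And>K. K \<ge> M \<Longrightarrow> outcome r (Q r) n (list_encode (map p [0..<K])) s \<noteq> 0"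
      using outcome_complete[OF x(1)] px by blast
    \<comment> \<open>The prefix must contain the evidence, and its code must exceed
      \<open>s\<close> for \<open>s\<close> to be examined.\<close>
    define K where "K = max M (Suc s)"
    have "s < list_encode (map p [0..<K])"
      using length_le_list_encode[of "map p [0..<K]"] unfolding K_def by simp
    then have "retraction_associate Q r (prod_encode (n, list_encode (map p [0..<K]))) \<noteq> 0"
      unfolding retraction_associate_def first_answer_eq_0 pfst_encode psnd_encode
      using s[of K] K_def by auto
    then show "\<exists>k. retraction_associate Q r (prod_encode (n, list_encode (map p [0..<k]))) \<noteq> 0" ..
  next
    fix n k v
    assume v: "retraction_associate Q r (prod_encode (n, list_encode (map p [0..<k]))) = Suc v"
    obtain s where "outcome r (Q r) n (list_encode (map p [0..<k])) s = Suc v"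
      using v first_answer_nonzero[of "list_encode (map p [0..<k])" "outcome r (Q r) n (list_encode (map p [0..<k]))"]
      unfolding retraction_associate_def pfst_encode psnd_encode by auto
    then show "dist (\<nu> v) (the (f x)) \<le> (1/2) ^ (n + 2)"
      using outcome_sound[OF x(1)] px by blast
  qed
  then show "\<exists>q y. eta (retraction_associate Q r) p q \<and> cauchy_rep \<nu> q y \<and> y \<in> set_option (f x)"
    using x(2) by auto
qed

end

section \<open>Computing the retraction from the two given machines\<close>

theorem theorem4p4:
  fixes \<nu> :: "nat \<Rightarrow> 'a::metric_space"
    and \<Y> :: "'a set set"
    and \<delta>Y :: "'a set rep"
  assumes "computable_metric_space \<nu>"
    and "\<Y> \<subseteq> {A. closed A \<and> subtopology euclidean A dim_le 0}"
    and "is_representation \<delta>Y \<Y>"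
    and "reducible \<delta>Y (corestrict (closed_rep \<nu>) \<Y>)"
    and "mv_computable (prod_rep (seq_rep (open_rep \<nu>)) \<delta>Y) (seq_rep (open_rep \<nu>)) (S_tilde \<Y>)"
  shows "mv_dom (E_retract \<Y>) = {(A, B) \<in> pairs_F \<Y>. B \<noteq> UNIV} \<and>
    {(A, B) \<in> pairs_F \<Y>. B \<noteq> UNIV} =
      {(A, B). A \<in> \<Y> \<and> closed B \<and> B \<noteq> {} \<and> B \<subseteq> A \<and> B \<noteq> UNIV} \<and>
    mv_computable (delta5 \<nu> \<Y> \<delta>Y) (cont_closed_dom_rep \<nu>) (E_retract \<Y>)"
proof (intro conjI)
  have dense: "closure (range \<nu>) = UNIV"
    using assms(1) unfolding computable_metric_space_def by blast
  have zero_dim: "closed A" "top_of_set A dim_le 0" if "A \<in> \<Y>" for A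
    using assms(2) that by auto
  show pairs: "{(A, B) \<in> pairs_F \<Y>. B \<noteq> UNIV} =
      {(A, B). A \<in> \<Y> \<and> closed B \<and> B \<noteq> {} \<and> B \<subseteq> A \<and> B \<noteq> UNIV}"
    by (auto simp: pairs_F_def)
  show "mv_dom (E_retract \<Y>) = {(A, B) \<in> pairs_F \<Y>. B \<noteq> UNIV}"
  proof
    show "mv_dom (E_retract \<Y>) \<subseteq> {(A, B) \<in> pairs_F \<Y>. B \<noteq> UNIV}"
      by (auto simp: mv_dom_def E_retract_def)
    show "{(A, B) \<in> pairs_F \<Y>. B \<noteq> UNIV} \<subseteq> mv_dom (E_retract \<Y>)"
      unfolding pairs using E_retract_nonempty[OF dense] zero_dim by (fastforce simp: mv_dom_def)
  qed
  obtain approx_prog where "\<forall>i j k. \<exists>m. eval (\<lambda>_. 0) approx_prog [i, j, k] m \<and>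
      \<bar>of_rat (rat_num m) - dist (\<nu> i) (\<nu> j)\<bar> \<le> (1/2) ^ k"
    using assms(1) unfolding computable_metric_space_def by blast
  then obtain approx where approx: "\<And>i j k. eval (\<lambda>_. 0) approx_prog [i, j, k] (approx i j k)"
      "\<And>i j k. \<bar>of_rat (rat_num (approx i j k)) - dist (\<nu> i) (\<nu> j)\<bar> \<le> (1/2) ^ k"
    by metis
  interpret metric_approximation \<nu> approx approx_prog
    using dense approx by unfold_locales
  \<comment> \<open>\<open>far_ball_name r\<close> names open sets for every \<open>r\<close>, so
    both given machines produce output for \<open>r\<close> in \<open>D\<close>.\<close>
  define D where "D = {r. \<exists>A. \<delta>Y (baire_fst r) A}"
  have \<delta>Y: "A \<in> \<Y>" "\<delta>Y p A' \<Longrightarrow> A' = A" if "\<delta>Y p A" for p A A'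
    using assms(3) that unfolding is_representation_def by blast+

  obtain closed_prog where closed_prog:
    "realizer (machine_fun closed_prog) \<delta>Y (corestrict (closed_rep \<nu>) \<Y>) (\<lambda>A. {A})"
    using assms(4) unfolding reducible_def mv_computable_def by blast
  \<comment> \<open>The output \<open>q\<close> can be chosen before \<open>A\<close> because a name
    determines its set.\<close>
  have "\<exists>q. machine_fun closed_prog (baire_fst r) q \<and> (\<forall>A. \<delta>Y (baire_fst r) A \<longrightarrow> closed_rep \<nu> q A)"
    if "r \<in> D" for r
  proof -
    obtain A where A: "\<delta>Y (baire_fst r) A" using \<open>r \<in> D\<close> unfolding D_def by blast
    then obtain q where "machine_fun closed_prog (baire_fst r) q" "closed_rep \<nu> q A"
      using closed_prog unfolding realizer_def mv_dom_def corestrict_def by blast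
    then show ?thesis using \<delta>Y(2)[OF A] by blast
  qed
  then obtain C where C: "\<And>r. r \<in> D \<Longrightarrow> machine_fun closed_prog (baire_fst r) (C r)"
      "\<And>r A. r \<in> D \<Longrightarrow> \<delta>Y (baire_fst r) A \<Longrightarrow> closed_rep \<nu> (C r) A"
    by metis

  obtain refine_prog where refine_prog: "realizer (machine_fun refine_prog)
      (prod_rep (seq_rep (open_rep \<nu>)) \<delta>Y) (seq_rep (open_rep \<nu>)) (S_tilde \<Y>)"
    using assms(5) unfolding mv_computable_def by blast
  have "\<exists>q. machine_fun refine_prog (refinement_input r) q \<and>
      (\<forall>A. \<delta>Y (baire_fst r) A \<longrightarrow> (\<exists>W\<in>S_tilde \<Y> (far_ball r, A). seq_rep (open_rep \<nu>) q W))"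
    if "r \<in> D" for r
  proof -
    obtain A where A: "\<delta>Y (baire_fst r) A" using \<open>r \<in> D\<close> unfolding D_def by blast
    have "A \<in> \<Y>" using \<delta>Y(1)[OF A] .
    \<comment> \<open>The realizer promises output only where \<open>S_tilde\<close> has a value;
      dimension zero supplies one.\<close>
    obtain W where "\<And>i. open (W i)" "\<And>i. W i \<subseteq> far_ball r i"
      "(\<Union>i. W i) \<inter> A = (\<Union>i. far_ball r i) \<inter> A" "\<And>i j. i \<noteq> j \<Longrightarrow> W i \<inter> W j = {}"
      using zero_dimensional_disjoint_refinement[OF dense zero_dim(2)[OF \<open>A \<in> \<Y>\<close>], of "far_ball r"]
        open_far_ball by blast
    then have "W \<in> S_tilde \<Y> (far_ball r, A)"
      unfolding S_tilde_def using \<open>A \<in> \<Y>\<close> open_far_ball by simp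
    then have "(far_ball r, A) \<in> mv_dom (S_tilde \<Y>)" unfolding mv_dom_def by blast
    moreover have "prod_rep (seq_rep (open_rep \<nu>)) \<delta>Y (refinement_input r) (far_ball r, A)"
      unfolding prod_rep_def prod.case refinement_input_parts using far_ball_name A by blast
    ultimately obtain q W where "machine_fun refine_prog (refinement_input r) q"
        "W \<in> S_tilde \<Y> (far_ball r, A)" "seq_rep (open_rep \<nu>) q W"
      using refine_prog unfolding realizer_def by blast
    then show ?thesis using \<delta>Y(2)[OF A] by blast
  qed
  then obtain Q where Q: "\<And>r. r \<in> D \<Longrightarrow> machine_fun refine_prog (refinement_input r) (Q r)"
      "\<And>r A. r \<in> D \<Longrightarrow> \<delta>Y (baire_fst r) A \<Longrightarrow>
        \<exists>W\<in>S_tilde \<Y> (far_ball r, A). seq_rep (open_rep \<nu>) (Q r) W"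
    by metis

  \<comment> \<open>Even positions carry the associate, odd positions the name of the closed domain
    \<open>A\<close>.\<close>
  define out where "out r n = (if even n then retraction_associate Q r (n div 2) else C r (n div 2))" for r n
  have C_comp: "computable_on D C"
    by (rule computable_on_machine[OF _ C(1)]) (intro computable computable_on_oracle_id)
  have Q_comp: "computable_on D (retraction_associate Q)"
    by (intro computable_on_retraction_associate computable_on_machine[OF computable_on_refinement_input Q(1)])
  have "computable_on D out"
    unfolding out_def by (intro computable computable_on_subst[OF C_comp] computable_on_subst[OF Q_comp])
  then obtain prog where prog: "\<And>r n. r \<in> D \<Longrightarrow> eval r prog [n] (out r n)"
    by (rule computable_onE) blast

  show "mv_computable (delta5 \<nu> \<Y> \<delta>Y) (cont_closed_dom_rep \<nu>) (E_retract \<Y>)"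
    unfolding mv_computable_def realizer_def
  proof (intro exI[of _ prog] allI impI)
    fix r x assume rx: "delta5 \<nu> \<Y> \<delta>Y r x \<and> x \<in> mv_dom (E_retract \<Y>)"
    obtain A B where x: "x = (A, B)" by (cases x)
    have A: "\<delta>Y (baire_fst r) A" and "range_rep \<nu> (baire_fst (baire_snd r)) B"
      and dist: "dist_lower_rep \<nu> (baire_snd (baire_snd r)) B"
      and AB: "A \<in> \<Y>" "closed B" "B \<noteq> {}" "B \<subseteq> A" "B \<noteq> UNIV"
      using rx unfolding x delta5_def corestrict_def prod_rep_def meet_rep_def mv_dom_def E_retract_def
        pairs_F_def by auto
    then obtain b where b: "seq_rep (cauchy_rep \<nu>) (baire_fst (baire_snd r)) b" "range b \<subseteq> B"
        "B \<subseteq> closure (range b)"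
      unfolding range_rep_def by blast
    have "r \<in> D" unfolding D_def using A by blast
    then obtain W where W: "W \<in> S_tilde \<Y> (far_ball r, A)" "seq_rep (open_rep \<nu>) (Q r) W"
      using Q(2) A by blast
    interpret retraction_names \<nu> approx approx_prog \<Y> A B b W r Q
    proof
      show "cauchy_rep \<nu> (point_name r j) (b j)" for j
        using b(1) unfolding seq_rep_def baire_nth_def point_name_def by blast
      show "realizer (eta (dist_name r)) (cauchy_rep \<nu>) lower_rep (\<lambda>x. {dist_fun B x})"
        using dist unfolding dist_lower_rep_def dist_name_def by blast
    qed (fact zero_dim(1)[OF AB(1)] AB b W)+
    have f: "f \<in> E_retract \<Y> (A, B)"
      by (rule retraction_in_E_retract[OF AB(1,3,5)])
    have parts: "baire_fst (out r) = retraction_associate Q r" "baire_snd (out r) = C r"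
      by (auto simp: out_def baire_fst_def baire_snd_def)
    have "cont_closed_dom_rep \<nu> (out r) f"
      unfolding cont_closed_dom_rep_def parts dom_retraction
      using f retraction_associate_realizer C(2)[OF \<open>r \<in> D\<close> A] unfolding E_retract_def by blast
    moreover have "machine_fun prog r (out r)"
      unfolding machine_fun_def using prog[OF \<open>r \<in> D\<close>] by blast
    ultimately show "\<exists>q y. machine_fun prog r q \<and> cont_closed_dom_rep \<nu> q y \<and> y \<in> E_retract \<Y> x"
      using f unfolding x by blast
  qed
qed

end
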